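(* Let $k\in\mathbb{N}$, let $\mathbb{D}_Q\subset\mathbb{M}^d$ be an NC operator ball, and let $F\in M_k(H^\infty(\mathbb{D}_Q))$ be $Q$-stable and accretive. Then $F$ is left cyclic and right cyclic in $M_k(H^\infty(\mathbb{D}_Q))$.
   Context: Fix $d\in\mathbb{N}$. Write $M_n$ for the complex $n\times n$ matrices, $M_n^d$ for $d$-tuples of such matrices, and $\mathbb{M}^d=\bigsqcup_{n\ge1}M_n^d$; for $\Omega\subseteq\mathbb{M}^d$ let $\Omega(n)=\Omega\cap M_n^d$. Let $\mathcal{H}$ be a Hilbert space, let $\mathcal{E}\subseteq B(\mathcal{H})$ be a $d$-dimensional linear subspace (operator space) with basis $Q_1,\dots,Q_d$, and put $Q(X)=\sum_{j=1}^d Q_j\otimes X_j\in B(\mathcal{H}\otimes\mathbb{C}^n)$ for $X\in M_n^d$. The NC operator ball is $\mathbb{D}_Q=\{X\in\mathbb{M}^d:\|Q(X)\|<1\}$. A function $F:\mathbb{D}_Q\to\mathbb{M}^1$ is NC if $F(X)\in M_n$ for $X\in\mathbb{D}_Q(n)$, $F(X\oplus Y)=F(X)\oplus F(Y)$ for $X,Y\in\mathbb{D}_Q$, and $F(S^{-1}XS)=S^{-1}F(X)S$ whenever $X,S^{-1}XS\in\mathbb{D}_Q(n)$, $S\in GL_n$. $H^\infty(\mathbb{D}_Q)$ is the Banach algebra of NC functions $F$ on $\mathbb{D}_Q$ with $\|F\|_Q=\sup_{X\in\mathbb{D}_Q}\|F(X)\|<\infty$. $M_k(H^\infty(\mathbb{D}_Q))$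 has pointwise evaluation $F(X)=(F_{ij}(X))\in M_k(M_n)$ and norm $\|F\|_Q=\sup_{X\in\mathbb{D}_Q}\|F(X)\|$. $F\in M_k(H^\infty(\mathbb{D}_Q))$ is $Q$-stable if $\det F(X)\neq0$ for all $X\in\mathbb{D}_Q$, and accretive if $\operatorname{Re}F(X)=\tfrac12(F(X)+F(X)^* )\succeq0$ for all $X\in\mathbb{D}_Q$. Weak-* topology: let $\mathcal{X}(\mathbb{D}_Q)$ be the norm-closed span in $(H^\infty(\mathbb{D}_Q))^*$ of all functionals $F\mapsto\eta(F(X))$ with $n\in\mathbb{N}$, $X\in\mathbb{D}_Q(n)$, $\eta\in M_n^*$, and let $\mathcal{X}_k(\mathbb{D}_Q)=M_k^*\otimes\mathcal{X}(\mathbb{D}_Q)\subset(M_k(H^\infty(\mathbb{D}_Q)))^*$, i.e. all functionals $(F_{ij})\mapsto\sum_{i,j}\varphi_{ij}(F_{ij})$ with $\varphi_{ij}\in\mathcal{X}(\mathbb{D}_Q)$. It is a pre-dual of $M_k(H^\infty(\mathbb{D}_Q))$, and the weak-* topology is $\sigma(M_k(H^\infty(\mathbb{D}_Q)),\mathcal{X}_k(\mathbb{D}_Q))$. For $F\in M_k(H^\infty(\mathbb{D}_Q))$, let $[F]_L$ and $[F]_R$ be the weak-* closures of $\{GF:G\in M_k(H^\infty(\mathbb{D}_Q))\}$ and $\{FG:G\in M_k(H^\infty(\mathbb{D}_Q))\}$ respectively. $F$ is left (resp. right) cyclic if $[F]_L$ (resp. $[F]_R$) equals $M_k(H^\infty(\mathbb{D}_Q))$.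 *)

theory Defs
  imports
    "HOL-Library.FuncSet"
    "HOL-Analysis.L2_Norm"
    "HOL-Analysis.Abstract_Topology"
    "Jordan_Normal_Form.Determinant"
    "Jordan_Normal_Form.Schur_Decomposition"
begin

section \<open>Complex Hilbert spaces and operator spaces\<close>

text \<open>Completeness comes from \<open>banach\<close>; the real scalar multiplication is required to be the
  restriction of the complex one, so that real-linear library notions apply. The inner product is
  linear in the first argument.\<close>

class complex_hilbert_space = banach +
  fixes scaleC :: "complex \<Rightarrow> 'a \<Rightarrow> 'a"
    and cinner :: "'a \<Rightarrow> 'a \<Rightarrow> complex"
  assumes scaleC_add_right: "scaleC c (x + y) = scaleC c x + scaleC c y"
    and scaleC_add_left: "scaleC (c + d) x = scaleC c x + scaleC d x"
    and scaleC_scaleC: "scaleC c (scaleC d x) = scaleC (c * d) x"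
    and scaleC_of_real: "scaleC (complex_of_real r) x = scaleR r x"
    and cinner_commute: "cinner x y = cnj (cinner y x)"
    and cinner_add_left: "cinner (x + y) z = cinner x z + cinner y z"
    and cinner_scaleC_left: "cinner (scaleC c x) y = c * cinner x y"
    and norm_eq_sqrt_cinner: "norm x = sqrt (Re (cinner x x))"

instantiation complex :: complex_hilbert_space
begin
definition scaleC_complex :: "complex \<Rightarrow> complex \<Rightarrow> complex" where
  "scaleC_complex c x = c * x"
definition cinner_complex :: "complex \<Rightarrow> complex \<Rightarrow> complex" where
  "cinner_complex x y = x * cnj y"
instance
  by standard
     (auto simp: scaleC_complex_def cinner_complex_def algebra_simps scaleR_conv_of_real
        cmod_def power2_eq_square)
end

definition bounded_operators :: "('h::complex_hilbert_space \<Rightarrow> 'h) set" where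
  "bounded_operators = {T. bounded_linear T \<and> (\<forall>c x. T (scaleC c x) = scaleC c (T x))}"

text \<open>The family \<open>Q\<close>, indexed by a type with \<open>d\<close> elements, is a basis of the linear subspace
  \<open>E\<close> of \<open>B(H)\<close>; in particular \<open>E\<close> has dimension \<open>d\<close>.\<close>

definition operator_space_basis ::
  "('h::complex_hilbert_space \<Rightarrow> 'h) set \<Rightarrow> ('d::finite \<Rightarrow> 'h \<Rightarrow> 'h) \<Rightarrow> bool" where
  "operator_space_basis E Q \<longleftrightarrow>
     E \<subseteq> bounded_operators \<and>
     E = {\<lambda>x. \<Sum>j\<in>UNIV. scaleC (c j) (Q j x) |c. True} \<and>
     (\<forall>c. (\<forall>x. (\<Sum>j\<in>UNIV. scaleC (c j) (Q j x)) = 0) \<longrightarrow> (\<forall>j. c j = 0))"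


section \<open>Matrix tuples and norms\<close>

text \<open>An element of \<open>M\<^sub>n\<^sup>d\<close> is a function on the index type. As the index type is nonempty, the
  sets \<open>tuples n\<close> are pairwise disjoint and \<open>level\<close> recovers the size.\<close>

type_synonym 'd mtuple = "'d \<Rightarrow> complex mat"
type_synonym 'd ncfun = "'d mtuple \<Rightarrow> complex mat"

definition tuples :: "nat \<Rightarrow> ('d::finite) mtuple set" where
  "tuples n = {X. \<forall>j. X j \<in> carrier_mat n n}"

definition level :: "('d::finite) mtuple \<Rightarrow> nat" where
  "level X = (THE n. X \<in> tuples n)"

lemma level_eq:
  assumes "X \<in> tuples n"
  shows "level X = n"
  unfolding level_def
proof (rule the_equality)
  fix m assume "X \<in> tuples m"
  then have "X undefined \<in> carrier_mat m m" "X undefined \<in> carrier_mat n n"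
    using assms unfolding tuples_def by blast+
  then show "m = n" by auto
qed (rule assms)

definition dsum :: "complex mat \<Rightarrow> complex mat \<Rightarrow> complex mat" where
  "dsum A B = four_block_mat A (0\<^sub>m (dim_row A) (dim_col B)) (0\<^sub>m (dim_row B) (dim_col A)) B"

definition eucl_norm :: "complex vec \<Rightarrow> real" where
  "eucl_norm v = L2_set (\<lambda>i. norm (v $ i)) {..<dim_vec v}"

text \<open>The operator norm of a matrix with respect to the Euclidean norms.\<close>

definition mat_norm :: "complex mat \<Rightarrow> real" where
  "mat_norm A = (SUP v\<in>{v \<in> carrier_vec (dim_col A). eucl_norm v \<le> 1}. eucl_norm (A *\<^sub>v v))"

text \<open>The Hilbert space tensor product of \<open>H\<close> and \<open>\<complex>\<^sup>n\<close> is identified with \<open>H\<^sup>n\<close> by sending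
  \<open>h \<otimes> e\<^sub>b\<close> to the family with entry \<open>h\<close> at \<open>b\<close> and \<open>0\<close> elsewhere. An element of \<open>H\<^sup>n\<close> is given by
  the values of a function at \<open>0, \<dots>, n - 1\<close>. As \<open>X\<^sub>j e\<^sub>b = (\<Sum>a<n. (X\<^sub>j)\<^sub>a\<^sub>b e\<^sub>a)\<close>, the operator
  \<open>Q(X) = (\<Sum>j. Q\<^sub>j \<otimes> X\<^sub>j)\<close> acts as below.\<close>

definition tensor_op ::
  "('d::finite \<Rightarrow> 'h \<Rightarrow> 'h::complex_hilbert_space) \<Rightarrow> nat \<Rightarrow> 'd mtuple \<Rightarrow> (nat \<Rightarrow> 'h) \<Rightarrow> (nat \<Rightarrow> 'h)"
  where
  "tensor_op Q n X v = (\<lambda>a. \<Sum>b<n. \<Sum>j\<in>UNIV. scaleC (X j $$ (a, b)) (Q j (v b)))"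

definition tensor_op_norm ::
  "('d::finite \<Rightarrow> 'h \<Rightarrow> 'h::complex_hilbert_space) \<Rightarrow> nat \<Rightarrow> 'd mtuple \<Rightarrow> real" where
  "tensor_op_norm Q n X =
     (SUP v\<in>{v. L2_set (\<lambda>b. norm (v b)) {..<n} \<le> 1}.
        L2_set (\<lambda>a. norm (tensor_op Q n X v a)) {..<n})"

definition nc_ball_level ::
  "('d::finite \<Rightarrow> 'h \<Rightarrow> 'h::complex_hilbert_space) \<Rightarrow> nat \<Rightarrow> 'd mtuple set" where
  "nc_ball_level Q n = {X \<in> tuples n. tensor_op_norm Q n X < 1}"

definition nc_ball :: "('d::finite \<Rightarrow> 'h \<Rightarrow> 'h::complex_hilbert_space) \<Rightarrow> 'd mtuple set" where
  "nc_ball Q = (\<Union>n\<in>{1..}. nc_ball_level Q n)"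


section \<open>Bounded NC functions\<close>

text \<open>Functions on the ball are represented extensionally, so that equality in HOL is equality on
  the ball.\<close>

definition nc_function ::
  "('d::finite \<Rightarrow> 'h \<Rightarrow> 'h::complex_hilbert_space) \<Rightarrow> 'd ncfun \<Rightarrow> bool" where
  "nc_function Q f \<longleftrightarrow>
     f \<in> extensional (nc_ball Q) \<and>
     (\<forall>n\<ge>1. \<forall>X\<in>nc_ball_level Q n. f X \<in> carrier_mat n n) \<and>
     (\<forall>X\<in>nc_ball Q. \<forall>Y\<in>nc_ball Q. f (\<lambda>j. dsum (X j) (Y j)) = dsum (f X) (f Y)) \<and>
     (\<forall>n\<ge>1. \<forall>X\<in>nc_ball_level Q n. \<forall>S\<in>carrier_mat n n. \<forall>S'\<in>carrier_mat n n.
        S * S' = 1\<^sub>m n \<longrightarrow> S' * S = 1\<^sub>m n \<longrightarrow> (\<lambda>j. S' * X j * S) \<in> nc_ball_level Q n \<longrightarrow>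
        f (\<lambda>j. S' * X j * S) = S' * f X * S)"

definition hinf :: "('d::finite \<Rightarrow> 'h \<Rightarrow> 'h::complex_hilbert_space) \<Rightarrow> 'd ncfun set" where
  "hinf Q = {f. nc_function Q f \<and> bdd_above ((\<lambda>X. mat_norm (f X)) ` nc_ball Q)}"

definition hinf_norm ::
  "('d::finite \<Rightarrow> 'h \<Rightarrow> 'h::complex_hilbert_space) \<Rightarrow> 'd ncfun \<Rightarrow> real" where
  "hinf_norm Q f = (SUP X\<in>nc_ball Q. mat_norm (f X))"

definition hinf_add ::
  "('d::finite \<Rightarrow> 'h \<Rightarrow> 'h::complex_hilbert_space) \<Rightarrow> 'd ncfun \<Rightarrow> 'd ncfun \<Rightarrow> 'd ncfun" where
  "hinf_add Q f g = (\<lambda>X\<in>nc_ball Q. f X + g X)"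

definition hinf_scale ::
  "('d::finite \<Rightarrow> 'h \<Rightarrow> 'h::complex_hilbert_space) \<Rightarrow> complex \<Rightarrow> 'd ncfun \<Rightarrow> 'd ncfun" where
  "hinf_scale Q c f = (\<lambda>X\<in>nc_ball Q. c \<cdot>\<^sub>m f X)"

definition mat_hinf ::
  "nat \<Rightarrow> ('d::finite \<Rightarrow> 'h \<Rightarrow> 'h::complex_hilbert_space) \<Rightarrow> 'd ncfun mat set" where
  "mat_hinf k Q = {F \<in> carrier_mat k k. \<forall>i<k. \<forall>j<k. F $$ (i, j) \<in> hinf Q}"

text \<open>The value \<open>F(X) = (F\<^sub>i\<^sub>j(X))\<close> as a matrix of size \<open>kn\<close>, consisting of \<open>k\<times>k\<close> blocks of
  size \<open>n\<close>.\<close>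

definition mat_eval :: "('d::finite) ncfun mat \<Rightarrow> 'd mtuple \<Rightarrow> complex mat" where
  "mat_eval F X =
     (let n = level X in
      mat (dim_row F * n) (dim_col F * n)
        (\<lambda>(p, q). (F $$ (p div n, q div n)) X $$ (p mod n, q mod n)))"

text \<open>The product of \<open>M\<^sub>k(H\<^sup>\<infinity>)\<close>: the \<open>(i, j)\<close> entry is \<open>(\<Sum>l<k. G\<^sub>i\<^sub>l F\<^sub>l\<^sub>j)\<close>, where the sum of matrices
  of unspecified size is written out entrywise. It is the pointwise product, see
  \<open>mat_eval_mult\<close> below.\<close>

definition mat_hinf_mult ::
  "('d::finite \<Rightarrow> 'h \<Rightarrow> 'h::complex_hilbert_space) \<Rightarrow> 'd ncfun mat \<Rightarrow> 'd ncfun mat \<Rightarrow> 'd ncfun mat"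
  where
  "mat_hinf_mult Q G F =
     mat (dim_row G) (dim_col F) (\<lambda>(i, j). \<lambda>X\<in>nc_ball Q.
       mat (level X) (level X)
         (\<lambda>(a, b). \<Sum>l<dim_col G. ((G $$ (i, l)) X * (F $$ (l, j)) X) $$ (a, b)))"

definition psd :: "complex mat \<Rightarrow> bool" where
  "psd A \<longleftrightarrow> mat_adjoint A = A \<and>
     (\<forall>v\<in>carrier_vec (dim_col A). 0 \<le> Re ((A *\<^sub>v v) \<bullet>c v))"

definition Q_stable ::
  "('d::finite \<Rightarrow> 'h \<Rightarrow> 'h::complex_hilbert_space) \<Rightarrow> 'd ncfun mat \<Rightarrow> bool" where
  "Q_stable Q F \<longleftrightarrow> (\<forall>X\<in>nc_ball Q. det (mat_eval F X) \<noteq> 0)"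

definition accretive ::
  "('d::finite \<Rightarrow> 'h \<Rightarrow> 'h::complex_hilbert_space) \<Rightarrow> 'd ncfun mat \<Rightarrow> bool" where
  "accretive Q F \<longleftrightarrow>
     (\<forall>X\<in>nc_ball Q. psd ((1/2) \<cdot>\<^sub>m (mat_eval F X + mat_adjoint (mat_eval F X))))"


section \<open>The weak-* topology and cyclicity\<close>

text \<open>Functionals are likewise extensional, here on \<open>hinf Q\<close>.\<close>

definition hinf_dual ::
  "('d::finite \<Rightarrow> 'h \<Rightarrow> 'h::complex_hilbert_space) \<Rightarrow> ('d ncfun \<Rightarrow> complex) set" where
  "hinf_dual Q = {\<phi> \<in> extensional (hinf Q).
     (\<forall>f\<in>hinf Q. \<forall>g\<in>hinf Q. \<phi> (hinf_add Q f g) = \<phi> f + \<phi> g) \<and>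
     (\<forall>c. \<forall>f\<in>hinf Q. \<phi> (hinf_scale Q c f) = c * \<phi> f) \<and>
     (\<exists>C. \<forall>f\<in>hinf Q. norm (\<phi> f) \<le> C * hinf_norm Q f)}"

definition dual_norm ::
  "('d::finite \<Rightarrow> 'h \<Rightarrow> 'h::complex_hilbert_space) \<Rightarrow> ('d ncfun \<Rightarrow> complex) \<Rightarrow> real" where
  "dual_norm Q \<phi> = (SUP f\<in>{f \<in> hinf Q. hinf_norm Q f \<le> 1}. norm (\<phi> f))"

definition mat_dual :: "nat \<Rightarrow> (complex mat \<Rightarrow> complex) set" where
  "mat_dual n = {\<eta>.
     (\<forall>A\<in>carrier_mat n n. \<forall>B\<in>carrier_mat n n. \<eta> (A + B) = \<eta> A + \<eta> B) \<and>
     (\<forall>c. \<forall>A\<in>carrier_mat n n. \<eta> (c \<cdot>\<^sub>m A) = c * \<eta> A)}"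

definition point_functionals ::
  "('d::finite \<Rightarrow> 'h \<Rightarrow> 'h::complex_hilbert_space) \<Rightarrow> ('d ncfun \<Rightarrow> complex) set" where
  "point_functionals Q =
     {\<lambda>f\<in>hinf Q. \<eta> (f X) |n X \<eta>. 1 \<le> n \<and> X \<in> nc_ball_level Q n \<and> \<eta> \<in> mat_dual n}"

definition point_functionals_span ::
  "('d::finite \<Rightarrow> 'h \<Rightarrow> 'h::complex_hilbert_space) \<Rightarrow> ('d ncfun \<Rightarrow> complex) set" where
  "point_functionals_span Q =
     {\<lambda>f\<in>hinf Q. \<Sum>i<m. c i * \<psi> i f |(m::nat) c \<psi>. \<forall>i<m. \<psi> i \<in> point_functionals Q}"

definition predual ::
  "('d::finite \<Rightarrow> 'h \<Rightarrow> 'h::complex_hilbert_space) \<Rightarrow> ('d ncfun \<Rightarrow> complex) set" where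
  "predual Q = {\<phi> \<in> hinf_dual Q.
     \<forall>\<epsilon>>0. \<exists>\<psi>\<in>point_functionals_span Q. dual_norm Q (\<lambda>f\<in>hinf Q. \<phi> f - \<psi> f) < \<epsilon>}"

definition mat_predual ::
  "nat \<Rightarrow> ('d::finite \<Rightarrow> 'h \<Rightarrow> 'h::complex_hilbert_space) \<Rightarrow> ('d ncfun mat \<Rightarrow> complex) set" where
  "mat_predual k Q =
     {\<lambda>F\<in>mat_hinf k Q. \<Sum>i<k. \<Sum>j<k. \<phi> i j (F $$ (i, j)) |\<phi>. \<forall>i<k. \<forall>j<k. \<phi> i j \<in> predual Q}"

text \<open>The initial topology on \<open>M\<^sub>k(H\<^sup>\<infinity>)\<close> with respect to the functionals in the predual.\<close>

definition weak_star ::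
  "nat \<Rightarrow> ('d::finite \<Rightarrow> 'h \<Rightarrow> 'h::complex_hilbert_space) \<Rightarrow> 'd ncfun mat topology" where
  "weak_star k Q =
     topology_generated_by {{F \<in> mat_hinf k Q. \<Phi> F \<in> U} |\<Phi> U. \<Phi> \<in> mat_predual k Q \<and> open U}"

definition left_cyclic ::
  "nat \<Rightarrow> ('d::finite \<Rightarrow> 'h \<Rightarrow> 'h::complex_hilbert_space) \<Rightarrow> 'd ncfun mat \<Rightarrow> bool" where
  "left_cyclic k Q F \<longleftrightarrow>
     weak_star k Q closure_of {mat_hinf_mult Q G F |G. G \<in> mat_hinf k Q} = mat_hinf k Q"

definition right_cyclic ::
  "nat \<Rightarrow> ('d::finite \<Rightarrow> 'h \<Rightarrow> 'h::complex_hilbert_space) \<Rightarrow> 'd ncfun mat \<Rightarrow> bool" where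
  "right_cyclic k Q F \<longleftrightarrow>
     weak_star k Q closure_of {mat_hinf_mult Q F G |G. G \<in> mat_hinf k Q} = mat_hinf k Q"


section \<open>Consistency of the encodings\<close>

lemma nc_ballE:
  assumes "X \<in> nc_ball Q"
  obtains n where "1 \<le> n" "X \<in> nc_ball_level Q n" "level X = n"
  using assms level_eq unfolding nc_ball_def nc_ball_level_def by fastforce

lemma mat_hinf_entry_carrier:
  assumes "F \<in> mat_hinf k Q" "i < k" "j < k" "X \<in> nc_ball Q"
  shows "(F $$ (i, j)) X \<in> carrier_mat (level X) (level X)"
proof -
  obtain n where n: "1 \<le> n" "X \<in> nc_ball_level Q n" "level X = n"
    using nc_ballE[OF assms(4)] .
  have "nc_function Q (F $$ (i, j))"
    using assms unfolding mat_hinf_def hinf_def by blast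
  then show ?thesis using n unfolding nc_function_def by blast
qed

lemma mat_eval_mult:
  assumes G: "G \<in> mat_hinf k Q" and F: "F \<in> mat_hinf k Q" and X: "X \<in> nc_ball Q"
  shows "mat_eval (mat_hinf_mult Q G F) X = mat_eval G X * mat_eval F X"
proof -
  define n where "n = level X"
  have dims: "dim_row G = k" "dim_col G = k" "dim_row F = k" "dim_col F = k"
    using G F unfolding mat_hinf_def by auto
  have carr: "(G $$ (i, j)) X \<in> carrier_mat n n" "(F $$ (i, j)) X \<in> carrier_mat n n"
    if "i < k" "j < k" for i j
    using mat_hinf_entry_carrier[OF G that X] mat_hinf_entry_carrier[OF F that X]
    unfolding n_def by auto
  have reindex: "(\<Sum>t<k * n. h (t div n) (t mod n)) = (\<Sum>l<k. \<Sum>c<n. h l c)"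
    for h :: "nat \<Rightarrow> nat \<Rightarrow> complex"
  proof (cases "n = 0")
    case False
    have "(\<Sum>l<k. \<Sum>c<n. h l c) = (\<Sum>(l, c)\<in>{..<k} \<times> {..<n}. h l c)"
      by (simp add: sum.cartesian_product)
    also have "\<dots> = (\<Sum>t<k * n. h (t div n) (t mod n))"
    proof (rule sum.reindex_bij_witness[where i = "\<lambda>t. (t div n, t mod n)"
            and j = "\<lambda>(l, c). l * n + c"], goal_cases)
      case (2 a)
      then obtain l c where a: "a = (l, c)" "l < k" "c < n" by auto
      have "l * n + c < l * n + n" using a by simp
      also have "\<dots> = Suc l * n" by simp
      also have "\<dots> \<le> k * n" using a by (intro mult_le_mono1) auto
      finally show ?case using a by simp
    qed (use False in \<open>auto simp: less_mult_imp_div_less\<close>)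
    finally show ?thesis by simp
  qed simp
  show ?thesis
  proof (rule eq_matI, goal_cases)
    case (1 p q)
    then have pq: "p < k * n" "q < k * n"
      by (simp_all add: mat_eval_def Let_def dims n_def)
    then have n0: "n > 0" by (cases n) auto
    have div: "p div n < k" "q div n < k" "p mod n < n" "q mod n < n"
      using pq n0 by (auto simp: less_mult_imp_div_less)
    have "mat_eval (mat_hinf_mult Q G F) X $$ (p, q) =
        (\<Sum>l<k. ((G $$ (p div n, l)) X * (F $$ (l, q div n)) X) $$ (p mod n, q mod n))"
      using pq div X by (simp add: mat_eval_def mat_hinf_mult_def Let_def dims n_def[symmetric])
    also have "\<dots> = (\<Sum>l<k. \<Sum>c<n. (G $$ (p div n, l)) X $$ (p mod n, c) *
        (F $$ (l, q div n)) X $$ (c, q mod n))"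
    proof (rule sum.cong[OF refl])
      fix l assume "l \<in> {..<k}"
      then have "(G $$ (p div n, l)) X \<in> carrier_mat n n" "(F $$ (l, q div n)) X \<in> carrier_mat n n"
        using carr div by auto
      then show "((G $$ (p div n, l)) X * (F $$ (l, q div n)) X) $$ (p mod n, q mod n) =
          (\<Sum>c<n. (G $$ (p div n, l)) X $$ (p mod n, c) * (F $$ (l, q div n)) X $$ (c, q mod n))"
        using div by (auto simp: scalar_prod_def atLeast0LessThan intro!: sum.cong)
    qed
    also have "\<dots> = (\<Sum>t<k * n. (G $$ (p div n, t div n)) X $$ (p mod n, t mod n) *
        (F $$ (t div n, q div n)) X $$ (t mod n, q mod n))"
      by (rule reindex[symmetric])
    also have "\<dots> = (mat_eval G X * mat_eval F X) $$ (p, q)"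
      using pq by (auto simp: mat_eval_def Let_def dims n_def[symmetric] scalar_prod_def
          atLeast0LessThan intro!: sum.cong)
    finally show ?case .
  qed (simp_all add: mat_eval_def mat_hinf_mult_def dims Let_def)
qed

end

theory Submission
  imports Defs
begin

text \<open>
  For \<open>\<epsilon> > 0\<close> the accretive function \<open>F\<close> has the resolvent \<open>R\<^sub>\<epsilon> = (F + \<epsilon>)\<inverse>\<close>, taken pointwise.
  Because \<open>\<parallel>(F(X) + \<epsilon>) v\<parallel>\<^sup>2 = \<parallel>F(X) v\<parallel>\<^sup>2 + 2 \<epsilon> Re \<langle>F(X) v, v\<rangle> + \<epsilon>\<^sup>2 \<parallel>v\<parallel>\<^sup>2\<close> and the middle term is
  nonnegative, \<open>\<parallel>R\<^sub>\<epsilon>(X)\<parallel>\<close> is at most \<open>1/\<epsilon>\<close> for every \<open>X\<close>, and at most \<open>\<parallel>F(X)\<inverse>\<parallel>\<close> for each single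
  \<open>X\<close> (\<open>accretive_resolvent\<close>). The first bound makes \<open>R\<^sub>\<epsilon>\<close> an element of \<open>M\<^sub>k(H\<^sup>\<infinity>)\<close>, because inverses of
  matrix-valued NC functions are again NC (\<open>nc_matfun_inverse\<close>).

  For \<open>H\<close> in \<open>M\<^sub>k(H\<^sup>\<infinity>)\<close>, the multiple \<open>(H R\<^sub>\<epsilon>) F\<close> of \<open>F\<close> equals \<open>H - \<epsilon> H R\<^sub>\<epsilon>\<close>. The error \<open>\<epsilon> H R\<^sub>\<epsilon>\<close>
  has norm at most \<open>\<parallel>H\<parallel>\<close> by the first bound, uniformly in \<open>\<epsilon>\<close> and \<open>X\<close>, and tends to \<open>0\<close> at each point by
  the second one, where stability enters; the norms of the inverses \<open>F(X)\<inverse>\<close> may well be unbounded in \<open>X\<close>.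
  Bounded pointwise convergence implies weak-* convergence, as the predual is the norm closure of the span of
  functionals that see only one point (\<open>predual_tendsto_zero\<close>, \<open>weak_star_closureI\<close>); so \<open>H\<close> lies in the
  closure of the left multiples of \<open>F\<close>. The multiples \<open>F (R\<^sub>\<epsilon> H) = H - \<epsilon> R\<^sub>\<epsilon> H\<close> serve for the other side.

  The algebraic closure properties of NC functions become short once respecting direct sums and
  similarities is rewritten as commuting with certain intertwining matrices
  (\<open>nc_function_iff_intertwining\<close>): a relation \<open>M(X') T = T M(X)\<close> passes to products and inverses by
  associativity. Elements of \<open>M\<^sub>k(H\<^sup>\<infinity>)\<close> are handled through their values \<open>F(X)\<close> of size \<open>kn\<close>, where the
  intertwiner \<open>T\<close> is replaced by \<open>I\<^sub>k \<otimes> T\<close>; \<open>nc_matfun_mat_eval\<close> and \<open>mat_hinf_of_nc_matfun\<close> translate in both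
  directions.
\<close>

section \<open>The operator norm of a matrix\<close>

lemma eucl_norm_nonneg [simp]: "0 \<le> eucl_norm v"
  by (simp add: eucl_norm_def)

lemma eucl_norm_zero [simp]: "eucl_norm (0\<^sub>v n) = 0"
  unfolding eucl_norm_def by (rule L2_set_0') auto

lemma eucl_norm_eq_0: "v \<in> carrier_vec n \<Longrightarrow> eucl_norm v = 0 \<Longrightarrow> v = 0\<^sub>v n"
  by (auto simp: eucl_norm_def L2_set_eq_0_iff intro!: eq_vecI)

lemma eucl_norm_smult: "eucl_norm (c \<cdot>\<^sub>v v) = cmod c * eucl_norm v"
  by (auto simp: eucl_norm_def norm_mult L2_set_right_distrib intro!: L2_set_cong)

lemma eucl_norm_add:
  assumes "v \<in> carrier_vec n" "w \<in> carrier_vec n"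
  shows "eucl_norm (v + w) \<le> eucl_norm v + eucl_norm w"
proof -
  have "eucl_norm (v + w) \<le> L2_set (\<lambda>i. cmod (v $ i) + cmod (w $ i)) {..<n}"
    unfolding eucl_norm_def using assms by (auto intro!: L2_set_mono norm_triangle_ineq)
  also have "\<dots> \<le> eucl_norm v + eucl_norm w"
    unfolding eucl_norm_def using assms L2_set_triangle_ineq[of "\<lambda>i. cmod (v $ i)" "\<lambda>i. cmod (w $ i)" "{..<n}"] by auto
  finally show ?thesis .
qed

lemma norm_index_le_eucl_norm: "i < dim_vec v \<Longrightarrow> cmod (v $ i) \<le> eucl_norm v"
  unfolding eucl_norm_def by (rule member_le_L2_set) auto

lemma eucl_norm_le_sum: "eucl_norm v \<le> (\<Sum>i<dim_vec v. cmod (v $ i))"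
  unfolding eucl_norm_def by (rule L2_set_le_sum) auto

lemma mult_mat_vec_index_sum:
  "A \<in> carrier_mat r c \<Longrightarrow> v \<in> carrier_vec c \<Longrightarrow> i < r \<Longrightarrow>
     (A *\<^sub>v v) $ i = (\<Sum>j<c. A $$ (i, j) * v $ j)"
  by (auto simp: scalar_prod_def atLeast0LessThan intro!: sum.cong)

text \<open>The supremum that defines the operator norm is only meaningful once it is known to be taken over
  a bounded set; the sum of the moduli of all entries is a crude bound.\<close>
lemma mat_norm_bdd:
  "bdd_above ((\<lambda>v. eucl_norm (A *\<^sub>v v)) ` {v \<in> carrier_vec (dim_col A). eucl_norm v \<le> 1})"
proof (rule bdd_aboveI2, safe)
  fix v :: "complex vec" assume v: "v \<in> carrier_vec (dim_col A)" "eucl_norm v \<le> 1"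
  have "eucl_norm (A *\<^sub>v v) \<le> (\<Sum>i<dim_row A. cmod ((A *\<^sub>v v) $ i))"
    using eucl_norm_le_sum[of "A *\<^sub>v v"] by simp
  also have "\<dots> = (\<Sum>i<dim_row A. cmod (\<Sum>j<dim_col A. A $$ (i, j) * v $ j))"
    using v by (intro sum.cong refl arg_cong[of _ _ cmod] mult_mat_vec_index_sum) auto
  also have "\<dots> \<le> (\<Sum>i<dim_row A. \<Sum>j<dim_col A. cmod (A $$ (i, j) * v $ j))"
    by (intro sum_mono norm_sum)
  also have "\<dots> \<le> (\<Sum>i<dim_row A. \<Sum>j<dim_col A. cmod (A $$ (i, j)))"
    using v norm_index_le_eucl_norm[of _ v]
    by (intro sum_mono) (force simp: norm_mult intro!: mult_left_le)
  finally show "eucl_norm (A *\<^sub>v v) \<le> (\<Sum>i<dim_row A. \<Sum>j<dim_col A. cmod (A $$ (i, j)))" .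
qed

lemma mat_norm_nonneg [simp]: "0 \<le> mat_norm A"
proof -
  have "eucl_norm (A *\<^sub>v 0\<^sub>v (dim_col A)) \<le> mat_norm A"
    unfolding mat_norm_def by (rule cSUP_upper[OF _ mat_norm_bdd]) auto
  then show ?thesis using eucl_norm_nonneg[of "A *\<^sub>v 0\<^sub>v (dim_col A)"] by linarith
qed

lemma eucl_norm_mult_mat_vec:
  assumes "A \<in> carrier_mat r c" "v \<in> carrier_vec c"
  shows "eucl_norm (A *\<^sub>v v) \<le> mat_norm A * eucl_norm v"
proof (cases "eucl_norm v = 0")
  case True
  then have "v = 0\<^sub>v c" using assms eucl_norm_eq_0 by blast
  moreover have "A *\<^sub>v 0\<^sub>v c = 0\<^sub>v r" using assms by auto
  ultimately show ?thesis by simp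
next
  case False
  then have pos: "eucl_norm v > 0" using eucl_norm_nonneg[of v] by linarith
  let ?c = "complex_of_real (inverse (eucl_norm v))"
  have "eucl_norm (A *\<^sub>v (?c \<cdot>\<^sub>v v)) \<le> mat_norm A"
    unfolding mat_norm_def using assms pos
    by (intro cSUP_upper[OF _ mat_norm_bdd]) (auto simp: eucl_norm_smult norm_inverse)
  also have "A *\<^sub>v (?c \<cdot>\<^sub>v v) = ?c \<cdot>\<^sub>v (A *\<^sub>v v)"
    using assms by (simp add: mult_mat_vec)
  finally have "inverse (eucl_norm v) * eucl_norm (A *\<^sub>v v) \<le> mat_norm A"
    using pos by (simp only: eucl_norm_smult norm_of_real) simp
  then show ?thesis using pos by (simp add: field_simps)
qed

lemma mat_norm_leI:
  assumes "A \<in> carrier_mat r c" "0 \<le> C"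
    "\<And>v. v \<in> carrier_vec c \<Longrightarrow> eucl_norm (A *\<^sub>v v) \<le> C * eucl_norm v"
  shows "mat_norm A \<le> C"
  unfolding mat_norm_def
proof (rule cSUP_least)
  have "0\<^sub>v c \<in> {v \<in> carrier_vec (dim_col A). eucl_norm v \<le> 1}" using assms(1) by auto
  then show "{v \<in> carrier_vec (dim_col A). eucl_norm v \<le> 1} \<noteq> {}" by blast
  fix v assume v: "v \<in> {v \<in> carrier_vec (dim_col A). eucl_norm v \<le> 1}"
  then have "eucl_norm (A *\<^sub>v v) \<le> C * eucl_norm v" using assms by auto
  also have "\<dots> \<le> C" using v assms by (auto intro: mult_left_le)
  finally show "eucl_norm (A *\<^sub>v v) \<le> C" .
qed

lemma mat_norm_mult:
  assumes A: "A \<in> carrier_mat r n" and B: "B \<in> carrier_mat n c"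
  shows "mat_norm (A * B) \<le> mat_norm A * mat_norm B"
proof (rule mat_norm_leI[of _ r c])
  fix v :: "complex vec" assume v: "v \<in> carrier_vec c"
  have "eucl_norm (A * B *\<^sub>v v) = eucl_norm (A *\<^sub>v (B *\<^sub>v v))"
    using A B v by (simp add: assoc_mult_mat_vec)
  also have "\<dots> \<le> mat_norm A * eucl_norm (B *\<^sub>v v)"
    using A B v by (intro eucl_norm_mult_mat_vec) auto
  also have "\<dots> \<le> mat_norm A * (mat_norm B * eucl_norm v)"
    using B v by (intro mult_left_mono eucl_norm_mult_mat_vec) auto
  finally show "eucl_norm (A * B *\<^sub>v v) \<le> mat_norm A * mat_norm B * eucl_norm v" by simp
qed (use A B in auto)

lemma mat_norm_add:
  assumes A: "A \<in> carrier_mat r c" and B: "B \<in> carrier_mat r c"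
  shows "mat_norm (A + B) \<le> mat_norm A + mat_norm B"
proof (rule mat_norm_leI[of _ r c])
  fix v :: "complex vec" assume v: "v \<in> carrier_vec c"
  have "eucl_norm ((A + B) *\<^sub>v v) = eucl_norm (A *\<^sub>v v + B *\<^sub>v v)"
    using A B v by (simp add: add_mult_distrib_mat_vec)
  also have "\<dots> \<le> eucl_norm (A *\<^sub>v v) + eucl_norm (B *\<^sub>v v)"
    using A B v by (intro eucl_norm_add[of _ r]) auto
  also have "\<dots> \<le> mat_norm A * eucl_norm v + mat_norm B * eucl_norm v"
    using A B v by (intro add_mono eucl_norm_mult_mat_vec) auto
  finally show "eucl_norm ((A + B) *\<^sub>v v) \<le> (mat_norm A + mat_norm B) * eucl_norm v"
    by (simp add: algebra_simps)
qed (use A B in auto)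

lemma mat_norm_smult:
  assumes A: "A \<in> carrier_mat r c"
  shows "mat_norm (a \<cdot>\<^sub>m A) \<le> cmod a * mat_norm A"
proof (rule mat_norm_leI[of _ r c])
  fix v :: "complex vec" assume v: "v \<in> carrier_vec c"
  have "(a \<cdot>\<^sub>m A) *\<^sub>v v = a \<cdot>\<^sub>v (A *\<^sub>v v)"
    using A v by (intro eq_vecI) auto
  then have "eucl_norm ((a \<cdot>\<^sub>m A) *\<^sub>v v) = cmod a * eucl_norm (A *\<^sub>v v)"
    by (simp add: eucl_norm_smult)
  also have "\<dots> \<le> cmod a * (mat_norm A * eucl_norm v)"
    using A v by (intro mult_left_mono eucl_norm_mult_mat_vec) auto
  finally show "eucl_norm ((a \<cdot>\<^sub>m A) *\<^sub>v v) \<le> cmod a * mat_norm A * eucl_norm v" by simp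
qed (use A in auto)

text \<open>The entry is a coordinate of the image of a unit vector. This is what makes linear functionals
  on matrices bounded with respect to the operator norm.\<close>
lemma norm_entry_le_mat_norm:
  assumes A: "A \<in> carrier_mat r c" and ij: "i < r" "j < c"
  shows "cmod (A $$ (i, j)) \<le> mat_norm A"
proof -
  have "eucl_norm (unit_vec c j) = 1"
    using ij by (simp add: eucl_norm_def L2_set_def unit_vec_def if_distrib[of "\<lambda>x. x\<^sup>2"] if_distrib[of cmod] cong: if_cong)
  moreover have "(A *\<^sub>v unit_vec c j) $ i = A $$ (i, j)" 
    using A ij by simp
  moreover have "cmod ((A *\<^sub>v unit_vec c j) $ i) \<le> eucl_norm (A *\<^sub>v unit_vec c j)"
    using A ij by (intro norm_index_le_eucl_norm) auto
  moreover have "eucl_norm (A *\<^sub>v unit_vec c j) \<le> mat_norm A * eucl_norm (unit_vec c j)"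
    using A by (intro eucl_norm_mult_mat_vec) auto
  ultimately show ?thesis by simp
qed

section \<open>Block matrices and amplifications\<close>

definition block :: "nat \<Rightarrow> nat \<Rightarrow> nat \<Rightarrow> complex mat \<Rightarrow> complex mat" where
  "block n i j M = mat n n (\<lambda>(a, b). M $$ (i * n + a, j * n + b))"

text \<open>The Kronecker product \<open>I\<^sub>k \<otimes> T\<close>, in the block convention of \<open>mat_eval\<close>.\<close>
definition amp :: "nat \<Rightarrow> complex mat \<Rightarrow> complex mat" where
  "amp k T = mat (k * dim_row T) (k * dim_col T)
     (\<lambda>(p, q). if p div dim_row T = q div dim_col T
              then T $$ (p mod dim_row T, q mod dim_col T) else 0)"

definition part :: "nat \<Rightarrow> nat \<Rightarrow> complex vec \<Rightarrow> complex vec" where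
  "part n i v = vec n (\<lambda>a. v $ (i * n + a))"

lemma block_carrier [simp]: "block n i j M \<in> carrier_mat n n"
  by (simp add: block_def)

lemma amp_carrier [simp]: "T \<in> carrier_mat n' n \<Longrightarrow> amp k T \<in> carrier_mat (k * n') (k * n)"
  by (auto simp: amp_def)

lemma part_carrier [simp]: "part n i v \<in> carrier_vec n"
  by (simp add: part_def)

lemma block_index_less: "i < k \<Longrightarrow> a < n \<Longrightarrow> i * n + a < k * (n::nat)"
proof -
  assume "i < k" "a < n"
  then have "i * n + a < Suc i * n" by simp
  also have "\<dots> \<le> k * n" using \<open>i < k\<close> by (intro mult_le_mono1) auto
  finally show ?thesis .
qed

lemma block_index_exhaust:
  assumes "p < k * (n::nat)"
  obtains i a where "p = i * n + a" "i < k" "a < n"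
proof
  have "n > 0" using assms by (cases n) auto
  then show "p mod n < n" by simp
  show "p div n < k" using assms by (simp add: less_mult_imp_div_less)
qed simp

lemma sum_blocks: "(\<Sum>t<k * n. h t) = (\<Sum>l<k. \<Sum>c<n. h (l * n + c))"
  for h :: "nat \<Rightarrow> 'a::comm_monoid_add"
proof -
  have "(\<Sum>t<k * n. h t) = (\<Sum>l<k. sum h {l * n..<l * n + n})"
    by (rule sum.nat_group[symmetric])
  also have "\<dots> = (\<Sum>l<k. \<Sum>c<n. h (l * n + c))"
  proof (rule sum.cong[OF refl])
    fix l
    show "sum h {l * n..<l * n + n} = (\<Sum>c<n. h (l * n + c))"
      using sum.shift_bounds_nat_ivl[of h 0 "l * n" n]
      by (simp add: atLeast0LessThan add.commute)
  qed
  finally show ?thesis .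
qed

lemma block_mat_eqI:
  assumes "M \<in> carrier_mat (k * n) (k * m)" "N \<in> carrier_mat (k * n) (k * m)"
    and "\<And>i j a b. i < k \<Longrightarrow> j < k \<Longrightarrow> a < n \<Longrightarrow> b < m \<Longrightarrow>
           M $$ (i * n + a, j * m + b) = N $$ (i * n + a, j * m + b)"
  shows "M = N"
proof (rule eq_matI)
  fix p q assume "p < dim_row N" "q < dim_col N"
  then have "p < k * n" "q < k * m" using assms by auto
  then show "M $$ (p, q) = N $$ (p, q)"
    using assms(3) by (elim block_index_exhaust) auto
qed (use assms in auto)

lemma block_eqI:
  assumes "M \<in> carrier_mat (k * n) (k * n)" "N \<in> carrier_mat (k * n) (k * n)"
    and "\<And>i j. i < k \<Longrightarrow> j < k \<Longrightarrow> block n i j M = block n i j N"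
  shows "M = N"
proof (rule block_mat_eqI[OF assms(1,2)])
  fix i j a b assume "i < k" "j < k" "a < n" "b < n"
  then show "M $$ (i * n + a, j * n + b) = N $$ (i * n + a, j * n + b)"
    using arg_cong[OF assms(3)[of i j], of "\<lambda>B. B $$ (a, b)"] by (simp add: block_def)
qed

lemma index_mult_blocks:
  assumes "M \<in> carrier_mat r (k * n)" "N \<in> carrier_mat (k * n) c" "p < r" "q < c"
  shows "(M * N) $$ (p, q) = (\<Sum>l<k. \<Sum>t<n. M $$ (p, l * n + t) * N $$ (l * n + t, q))"
proof -
  have "(M * N) $$ (p, q) = (\<Sum>t<k * n. M $$ (p, t) * N $$ (t, q))"
    using assms by (auto simp: scalar_prod_def atLeast0LessThan intro!: sum.cong)
  then show ?thesis by (simp only: sum_blocks)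
qed

lemma index_mult_mat_sum:
  assumes "M \<in> carrier_mat r n" "N \<in> carrier_mat n c" "p < r" "q < c"
  shows "(M * N) $$ (p, q) = (\<Sum>t<n. M $$ (p, t) * N $$ (t, q))"
  using assms by (auto simp: scalar_prod_def atLeast0LessThan intro!: sum.cong)

lemma index_amp:
  assumes "T \<in> carrier_mat n' n" "i < k" "j < k" "a < n'" "b < n"
  shows "amp k T $$ (i * n' + a, j * n + b) = (if i = j then T $$ (a, b) else 0)"
  using assms by (auto simp: amp_def block_index_less)

lemma index_mult_amp:
  assumes M: "M \<in> carrier_mat (k * n') (k * n')" and T: "T \<in> carrier_mat n' n"
    and ij: "i < k" "j < k" and ab: "a < n'" "b < n"
  shows "(M * amp k T) $$ (i * n' + a, j * n + b) = (block n' i j M * T) $$ (a, b)"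
proof -
  have "(M * amp k T) $$ (i * n' + a, j * n + b) =
      (\<Sum>l<k. \<Sum>t<n'. M $$ (i * n' + a, l * n' + t) * amp k T $$ (l * n' + t, j * n + b))"
    using M T ij ab by (intro index_mult_blocks[of _ "k * n'" _ _ _ "k * n"]) (auto simp: block_index_less)
  also have "\<dots> = (\<Sum>l<k. if l = j then \<Sum>t<n'. M $$ (i * n' + a, l * n' + t) * T $$ (t, b) else 0)"
    using T ij ab by (intro sum.cong refl) (auto simp: index_amp[OF T])
  also have "\<dots> = (\<Sum>t<n'. M $$ (i * n' + a, j * n' + t) * T $$ (t, b))"
    using ij by simp
  also have "\<dots> = (block n' i j M * T) $$ (a, b)"
    using ab by (subst index_mult_mat_sum[OF block_carrier T]) (auto simp: block_def)
  finally show ?thesis .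
qed

lemma index_amp_mult:
  assumes M: "M \<in> carrier_mat (k * n) (k * n)" and T: "T \<in> carrier_mat n' n"
    and ij: "i < k" "j < k" and ab: "a < n'" "b < n"
  shows "(amp k T * M) $$ (i * n' + a, j * n + b) = (T * block n i j M) $$ (a, b)"
proof -
  have "(amp k T * M) $$ (i * n' + a, j * n + b) =
      (\<Sum>l<k. \<Sum>t<n. amp k T $$ (i * n' + a, l * n + t) * M $$ (l * n + t, j * n + b))"
    using M T ij ab by (intro index_mult_blocks[of _ "k * n'" _ _ _ "k * n"]) (auto simp: block_index_less)
  also have "\<dots> = (\<Sum>l<k. if l = i then \<Sum>t<n. T $$ (a, t) * M $$ (l * n + t, j * n + b) else 0)"
    using T ij ab by (intro sum.cong refl) (auto simp: index_amp[OF T])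
  also have "\<dots> = (\<Sum>t<n. T $$ (a, t) * M $$ (i * n + t, j * n + b))"
    using ij by simp
  also have "\<dots> = (T * block n i j M) $$ (a, b)"
    using ab by (subst index_mult_mat_sum[OF T block_carrier]) (auto simp: block_def)
  finally show ?thesis .
qed

text \<open>As \<open>I\<^sub>k \<otimes> T\<close> is block diagonal, multiplying by it acts on every block separately. This passes
  between a matrix over \<open>H\<^sup>\<infinity>\<close> and its entries.\<close>
lemma amp_intertwines_iff:
  assumes M': "M' \<in> carrier_mat (k * n') (k * n')" and T: "T \<in> carrier_mat n' n"
    and M: "M \<in> carrier_mat (k * n) (k * n)"
  shows "M' * amp k T = amp k T * M \<longleftrightarrow>
    (\<forall>i<k. \<forall>j<k. block n' i j M' * T = T * block n i j M)" (is "?L \<longleftrightarrow> ?R")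
proof
  assume L: ?L
  show ?R
  proof (intro allI impI)
    fix i j assume ij: "i < k" "j < k"
    show "block n' i j M' * T = T * block n i j M"
    proof (rule eq_matI)
      fix a b assume "a < dim_row (T * block n i j M)" "b < dim_col (T * block n i j M)"
      then have "a < n'" "b < n" using T by (auto simp: block_def)
      then show "(block n' i j M' * T) $$ (a, b) = (T * block n i j M) $$ (a, b)"
        using index_mult_amp[OF M' T ij] index_amp_mult[OF M T ij] L by metis
    qed (use T in \<open>auto simp: block_def\<close>)
  qed
next
  assume R: ?R
  show ?L
  proof (rule block_mat_eqI[of _ k n' n])
    fix i j a b assume ij: "i < k" "j < k" and ab: "a < n'" "b < n"
    then have "block n' i j M' * T = T * block n i j M" using R by blast
    then show "(M' * amp k T) $$ (i * n' + a, j * n + b) = (amp k T * M) $$ (i * n' + a, j * n + b)"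
      by (simp only: index_mult_amp[OF M' T ij ab] index_amp_mult[OF M T ij ab])
  next
    show "M' * amp k T \<in> carrier_mat (k * n') (k * n)"
      using M' amp_carrier[OF T, of k] by (rule mult_carrier_mat)
    show "amp k T * M \<in> carrier_mat (k * n') (k * n)"
      using amp_carrier[OF T, of k] M by (rule mult_carrier_mat)
  qed
qed

lemma L2_set_sum_le:
  assumes "finite J"
  shows "L2_set (\<lambda>a. \<Sum>j\<in>J. f j a) A \<le> (\<Sum>j\<in>J. L2_set (f j) A)"
  using assms
proof (induction J)
  case empty
  then show ?case by (simp add: L2_set_0')
next
  case (insert j J)
  then show ?case
    using L2_set_triangle_ineq[of "f j" "\<lambda>a. \<Sum>j\<in>J. f j a" A] by simp
qed

lemma eucl_norm_parts:
  assumes "v \<in> carrier_vec (k * n)"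
  shows "eucl_norm v = L2_set (\<lambda>i. eucl_norm (part n i v)) {..<k}"
proof -
  have "eucl_norm v = sqrt (\<Sum>q<k * n. (cmod (v $ q))\<^sup>2)"
    using assms by (simp add: eucl_norm_def L2_set_def)
  also have "\<dots> = sqrt (\<Sum>i<k. \<Sum>a<n. (cmod (v $ (i * n + a)))\<^sup>2)"
    by (simp only: sum_blocks)
  also have "\<dots> = L2_set (\<lambda>i. eucl_norm (part n i v)) {..<k}"
    unfolding eucl_norm_def L2_set_def by (simp add: part_def sum_nonneg)
  finally show ?thesis .
qed

lemma index_mult_part:
  assumes M: "M \<in> carrier_mat (k * n) (k * n)" and v: "v \<in> carrier_vec (k * n)"
    and i: "i < k" and a: "a < n"
  shows "part n i (M *\<^sub>v v) $ a = (\<Sum>j<k. (block n i j M *\<^sub>v part n j v) $ a)"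
proof -
  have "part n i (M *\<^sub>v v) $ a = (\<Sum>q<k * n. M $$ (i * n + a, q) * v $ q)"
    using a block_index_less[OF i a] mult_mat_vec_index_sum[OF M v] by (simp add: part_def)
  also have "\<dots> = (\<Sum>j<k. \<Sum>b<n. M $$ (i * n + a, j * n + b) * v $ (j * n + b))"
    by (rule sum_blocks)
  also have "\<dots> = (\<Sum>j<k. (block n i j M *\<^sub>v part n j v) $ a)"
    using a by (intro sum.cong refl, subst mult_mat_vec_index_sum[OF block_carrier part_carrier])
      (auto simp: block_def part_def)
  finally show ?thesis .
qed

text \<open>A block is the compression of the matrix to two coordinate subspaces, so it suffices to test on
  vectors supported in the \<open>j\<close>-th part. With the next bound this shows that a matrix-valued function is
  bounded iff its entries are, with constants that depend on \<open>k\<close> but not on the block size \<open>n\<close>.\<close>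
lemma mat_norm_block:
  assumes M: "M \<in> carrier_mat (k * n) (k * n)" and i: "i < k" and j: "j < k"
  shows "mat_norm (block n i j M) \<le> mat_norm M"
proof (rule mat_norm_leI[OF block_carrier])
  fix v :: "complex vec" assume v: "v \<in> carrier_vec n"
  define w where "w = vec (k * n) (\<lambda>q. if q div n = j then v $ (q mod n) else 0)"
  have w: "w \<in> carrier_vec (k * n)" by (simp add: w_def)
  have part_w: "part n l w = (if l = j then v else 0\<^sub>v n)" if "l < k" for l
    using v that by (intro eq_vecI) (auto simp: part_def w_def block_index_less)
  have "eucl_norm w = L2_set (\<lambda>l. if l = j then eucl_norm v else 0) {..<k}"
    unfolding eucl_norm_parts[OF w] by (intro L2_set_cong) (auto simp: part_w)
  also have "\<dots> = eucl_norm v"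
    using j by (simp add: L2_set_def if_distrib[of "\<lambda>x. x\<^sup>2"] cong: if_cong)
  finally have norm_w: "eucl_norm w = eucl_norm v" .
  have "part n i (M *\<^sub>v w) = block n i j M *\<^sub>v v"
  proof (rule eq_vecI)
    fix a assume "a < dim_vec (block n i j M *\<^sub>v v)"
    then have a: "a < n" by (simp add: block_def)
    have "(block n i l M *\<^sub>v part n l w) $ a = (if l = j then (block n i j M *\<^sub>v v) $ a else 0)"
      if "l < k" for l
      using that a by (simp add: part_w block_def row_def)
    then have "part n i (M *\<^sub>v w) $ a = (\<Sum>l<k. if l = j then (block n i j M *\<^sub>v v) $ a else 0)"
      unfolding index_mult_part[OF M w i a] by (intro sum.cong) auto
    then show "part n i (M *\<^sub>v w) $ a = (block n i j M *\<^sub>v v) $ a" using j by simp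
  qed (simp add: part_def block_def)
  then have "eucl_norm (block n i j M *\<^sub>v v) = eucl_norm (part n i (M *\<^sub>v w))" by simp
  also have "\<dots> \<le> eucl_norm (M *\<^sub>v w)"
    using M w i by (subst eucl_norm_parts[of "M *\<^sub>v w" k n]) (auto intro!: member_le_L2_set)
  also have "\<dots> \<le> mat_norm M * eucl_norm w"
    by (rule eucl_norm_mult_mat_vec[OF M w])
  finally show "eucl_norm (block n i j M *\<^sub>v v) \<le> mat_norm M * eucl_norm v"
    by (simp add: norm_w)
qed simp

lemma mat_norm_le_sum_blocks:
  assumes M: "M \<in> carrier_mat (k * n) (k * n)"
  shows "mat_norm M \<le> (\<Sum>i<k. \<Sum>j<k. mat_norm (block n i j M))"
proof (rule mat_norm_leI[OF M])
  fix v :: "complex vec" assume v: "v \<in> carrier_vec (k * n)"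
  have part_le: "eucl_norm (part n j v) \<le> eucl_norm v" if "j < k" for j
    using that by (subst eucl_norm_parts[OF v]) (auto intro!: member_le_L2_set)
  have row: "eucl_norm (part n i (M *\<^sub>v v)) \<le> (\<Sum>j<k. mat_norm (block n i j M) * eucl_norm v)"
    if i: "i < k" for i
  proof -
    have "eucl_norm (part n i (M *\<^sub>v v)) =
        L2_set (\<lambda>a. cmod (\<Sum>j<k. (block n i j M *\<^sub>v part n j v) $ a)) {..<n}"
      unfolding eucl_norm_def
      by (intro L2_set_cong) (auto simp: part_def[of _ _ "M *\<^sub>v v"] index_mult_part[OF M v i, symmetric])
    also have "\<dots> \<le> L2_set (\<lambda>a. \<Sum>j<k. cmod ((block n i j M *\<^sub>v part n j v) $ a)) {..<n}"
      by (intro L2_set_mono norm_sum) auto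
    also have "\<dots> \<le> (\<Sum>j<k. L2_set (\<lambda>a. cmod ((block n i j M *\<^sub>v part n j v) $ a)) {..<n})"
      by (rule L2_set_sum_le) simp
    also have "\<dots> = (\<Sum>j<k. eucl_norm (block n i j M *\<^sub>v part n j v))"
      unfolding eucl_norm_def by (simp add: block_def)
    also have "\<dots> \<le> (\<Sum>j<k. mat_norm (block n i j M) * eucl_norm v)"
    proof (rule sum_mono)
      fix j assume "j \<in> {..<k}"
      then have "mat_norm (block n i j M) * eucl_norm (part n j v) \<le> mat_norm (block n i j M) * eucl_norm v"
        by (intro mult_left_mono part_le) auto
      then show "eucl_norm (block n i j M *\<^sub>v part n j v) \<le> mat_norm (block n i j M) * eucl_norm v"
        using eucl_norm_mult_mat_vec[OF block_carrier part_carrier] order_trans by blast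
    qed
    finally show ?thesis .
  qed
  have "eucl_norm (M *\<^sub>v v) = L2_set (\<lambda>i. eucl_norm (part n i (M *\<^sub>v v))) {..<k}"
    using M v by (intro eucl_norm_parts) auto
  also have "\<dots> \<le> (\<Sum>i<k. eucl_norm (part n i (M *\<^sub>v v)))"
    by (rule L2_set_le_sum) simp
  also have "\<dots> \<le> (\<Sum>i<k. \<Sum>j<k. mat_norm (block n i j M) * eucl_norm v)"
    by (intro sum_mono row) simp
  finally show "eucl_norm (M *\<^sub>v v) \<le> (\<Sum>i<k. \<Sum>j<k. mat_norm (block n i j M)) * eucl_norm v"
    by (simp add: sum_distrib_right)
qed (simp add: sum_nonneg)

section \<open>Geometry of the operator ball\<close>

lemma norm_scaleC: "norm (scaleC c x) = cmod c * norm (x::'h::complex_hilbert_space)"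
proof -
  have "cinner (scaleC c x) (scaleC c x) = c * cinner x (scaleC c x)"
    by (rule cinner_scaleC_left)
  also have "cinner x (scaleC c x) = cnj (c * cinner x x)"
    by (subst cinner_commute) (simp only: cinner_scaleC_left)
  also have "\<dots> = cnj c * cinner x x"
    by (simp only: complex_cnj_mult cinner_commute[of x x, symmetric])
  also have "c * (cnj c * cinner x x) = complex_of_real ((cmod c)\<^sup>2) * cinner x x"
    by (simp only: mult.assoc[symmetric] complex_norm_square)
  finally have "Re (cinner (scaleC c x) (scaleC c x)) = (cmod c)\<^sup>2 * Re (cinner x x)"
    by simp
  then show ?thesis
    by (simp only: norm_eq_sqrt_cinner[of "scaleC c x"] norm_eq_sqrt_cinner[of x]
        real_sqrt_mult real_sqrt_abs abs_norm_cancel)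
qed

lemma scaleC_zero_left [simp]: "scaleC 0 (x::'h::complex_hilbert_space) = 0"
  using scaleC_of_real[of 0 x] by simp

lemma scaleC_one [simp]: "scaleC 1 (x::'h::complex_hilbert_space) = x"
  using scaleC_of_real[of 1 x] by simp

lemma scaleC_zero_right [simp]: "scaleC c (0::'h::complex_hilbert_space) = 0"
  using norm_scaleC[of c "0::'h"] by simp

lemma scaleC_scaleR: "scaleC c (scaleR r x) = scaleR r (scaleC c (x::'h::complex_hilbert_space))"
  unfolding scaleC_of_real[symmetric] scaleC_scaleC by (simp add: mult.commute)

lemma operator_space_basis_bounded:
  assumes "operator_space_basis E Q"
  shows "Q j \<in> bounded_operators"
proof -
  have "(\<lambda>x. \<Sum>i\<in>UNIV. scaleC (if i = j then 1 else 0) (Q i x)) \<in> E"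
    using assms unfolding operator_space_basis_def
    by (auto intro!: exI[of _ "\<lambda>i. if i = j then 1 else 0"])
  also have "(\<lambda>x. \<Sum>i\<in>UNIV. scaleC (if i = j then 1 else 0) (Q i x)) = Q j"
    by (rule ext) (simp add: if_distrib[of "\<lambda>c. scaleC c y" for y] cong: if_cong)
  finally show ?thesis using assms unfolding operator_space_basis_def by blast
qed

abbreviation tuple_norm :: "nat \<Rightarrow> (nat \<Rightarrow> 'h::complex_hilbert_space) \<Rightarrow> real" where
  "tuple_norm n v \<equiv> L2_set (\<lambda>b. norm (v b)) {..<n}"

text \<open>Boundedness of the coefficient operators makes \<open>tensor_op_norm\<close> a genuine least upper bound.\<close>
lemma tensor_op_bdd:
  fixes Q :: "'d::finite \<Rightarrow> 'h \<Rightarrow> 'h::complex_hilbert_space"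
  assumes "\<forall>j. Q j \<in> bounded_operators"
  shows "bdd_above ((\<lambda>v. tuple_norm n (tensor_op Q n X v)) ` {v. tuple_norm n v \<le> 1})"
proof -
  have "\<exists>B\<ge>0. \<forall>x. norm (Q j x) \<le> norm x * B" for j
    using assms[rule_format, of j] unfolding bounded_operators_def
    by (intro bounded_linear.nonneg_bounded) simp
  then obtain B where B: "B j \<ge> 0" "norm (Q j x) \<le> norm x * B j" for j x by metis
  show ?thesis
  proof (rule bdd_aboveI2, safe)
    fix v :: "nat \<Rightarrow> 'h" assume v: "tuple_norm n v \<le> 1"
    have comp: "norm (v b) \<le> 1" if "b < n" for b
      using member_le_L2_set[of "{..<n}" b "\<lambda>b. norm (v b)"] that v by simp
    have "tuple_norm n (tensor_op Q n X v) \<le> (\<Sum>a<n. norm (tensor_op Q n X v a))"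
      by (rule L2_set_le_sum) simp
    also have "\<dots> \<le> (\<Sum>a<n. \<Sum>b<n. \<Sum>j\<in>UNIV. norm (scaleC (X j $$ (a, b)) (Q j (v b))))"
      unfolding tensor_op_def by (intro sum_mono order_trans[OF norm_sum] order_refl)
    also have "\<dots> \<le> (\<Sum>a<n. \<Sum>b<n. \<Sum>j\<in>UNIV. cmod (X j $$ (a, b)) * B j)"
    proof (intro sum_mono)
      fix a b j assume "b \<in> {..<n}"
      then have "norm (Q j (v b)) \<le> B j"
        using B(2)[where j = j and x = "v b"] mult_right_mono[OF comp B(1)[where j = j], of b] by simp
      then show "norm (scaleC (X j $$ (a, b)) (Q j (v b))) \<le> cmod (X j $$ (a, b)) * B j"
        by (simp add: norm_scaleC mult_left_mono)
    qed
    finally show "tuple_norm n (tensor_op Q n X v) \<le>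
      (\<Sum>a<n. \<Sum>b<n. \<Sum>j\<in>UNIV. cmod (X j $$ (a, b)) * B j)" .
  qed
qed

lemma tensor_op_norm_nonneg:
  assumes "\<forall>j. Q j \<in> bounded_operators"
  shows "0 \<le> tensor_op_norm Q n X"
proof -
  have "tuple_norm n (tensor_op Q n X (\<lambda>_. 0)) \<le> tensor_op_norm Q n X"
    unfolding tensor_op_norm_def
    by (rule cSUP_upper[OF _ tensor_op_bdd[OF assms]]) (simp add: L2_set_0')
  then show ?thesis using L2_set_nonneg order_trans by blast
qed

lemma tensor_op_le:
  fixes Q :: "'d::finite \<Rightarrow> 'h \<Rightarrow> 'h::complex_hilbert_space"
  assumes Q: "\<forall>j. Q j \<in> bounded_operators"
  shows "tuple_norm n (tensor_op Q n X v) \<le> tensor_op_norm Q n X * tuple_norm n v"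
proof (cases "tuple_norm n v = 0")
  case True
  have "Q j 0 = 0" for j
    using Q[rule_format, of j] unfolding bounded_operators_def by (auto intro: linear_0 bounded_linear.linear)
  moreover have "v b = 0" if "b < n" for b
    using True that by (simp add: L2_set_eq_0_iff)
  ultimately have "tensor_op Q n X v a = 0" for a by (simp add: tensor_op_def)
  then show ?thesis by (simp add: True L2_set_0')
next
  case False
  define r where "r = inverse (tuple_norm n v)"
  have r: "r > 0" using False by (simp add: r_def order_less_le)
  have Qr: "Q j (scaleR r x) = scaleR r (Q j x)" for j x
    using Q[rule_format, of j] unfolding bounded_operators_def by (auto intro: linear_scale bounded_linear.linear)
  have norm_scale: "tuple_norm n (\<lambda>b. scaleR r (w b)) = r * tuple_norm n w" for w :: "nat \<Rightarrow> 'h"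
    using r by (simp add: L2_set_right_distrib)
  have "tensor_op Q n X (\<lambda>b. scaleR r (v b)) = (\<lambda>a. scaleR r (tensor_op Q n X v a))"
    by (simp add: tensor_op_def Qr scaleC_scaleR scaleR_sum_right)
  moreover have "tuple_norm n (tensor_op Q n X (\<lambda>b. scaleR r (v b))) \<le> tensor_op_norm Q n X"
    unfolding tensor_op_norm_def
  proof (rule cSUP_upper[OF _ tensor_op_bdd[OF Q]], unfold mem_Collect_eq)
    show "tuple_norm n (\<lambda>b. scaleR r (v b)) \<le> 1"
      unfolding norm_scale using False by (simp add: r_def)
  qed
  ultimately have "r * tuple_norm n (tensor_op Q n X v) \<le> tensor_op_norm Q n X"
    by (simp only: norm_scale)
  then show ?thesis using r by (simp add: r_def field_simps)
qed

lemma sum_lessThan_add: "(\<Sum>b<n + m. f b) = (\<Sum>b<n. f b) + (\<Sum>b<m. f (n + b))"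
  for f :: "nat \<Rightarrow> 'a::comm_monoid_add"
  by (induction m) (simp_all add: add.assoc)

lemma L2_set_lessThan_add:
  "(L2_set f {..<n + m})\<^sup>2 = (L2_set f {..<n})\<^sup>2 + (L2_set (\<lambda>b. f (n + b)) {..<m})\<^sup>2"
  for f :: "nat \<Rightarrow> real"
  using sum_lessThan_add[of "\<lambda>i. (f i)\<^sup>2" n m] by (simp add: L2_set_def sum_nonneg)

lemma dsum_carrier [simp]:
  "A \<in> carrier_mat n n \<Longrightarrow> B \<in> carrier_mat m m \<Longrightarrow> dsum A B \<in> carrier_mat (n + m) (n + m)"
  by (auto simp: dsum_def)

lemma index_dsum:
  assumes "A \<in> carrier_mat n n" "B \<in> carrier_mat m m" "a < n + m" "b < n + m"
  shows "dsum A B $$ (a, b) =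
    (if a < n \<and> b < n then A $$ (a, b)
     else if n \<le> a \<and> n \<le> b then B $$ (a - n, b - n) else 0)"
  using assms by (auto simp: dsum_def)

lemma tensor_op_dsum:
  fixes Q :: "'d::finite \<Rightarrow> 'h \<Rightarrow> 'h::complex_hilbert_space"
  assumes X: "X \<in> tuples n" and Y: "Y \<in> tuples m"
  shows "a < n \<Longrightarrow> tensor_op Q (n + m) (\<lambda>j. dsum (X j) (Y j)) v a = tensor_op Q n X v a"
    and "a < m \<Longrightarrow> tensor_op Q (n + m) (\<lambda>j. dsum (X j) (Y j)) v (n + a) =
           tensor_op Q m Y (\<lambda>b. v (n + b)) a"
proof -
  have XY: "X j \<in> carrier_mat n n" "Y j \<in> carrier_mat m m" for j
    using X Y by (auto simp: tuples_def)
  note [simp] = index_dsum[OF XY]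
  show "a < n \<Longrightarrow> tensor_op Q (n + m) (\<lambda>j. dsum (X j) (Y j)) v a = tensor_op Q n X v a"
    by (simp add: tensor_op_def sum_lessThan_add)
  show "a < m \<Longrightarrow> tensor_op Q (n + m) (\<lambda>j. dsum (X j) (Y j)) v (n + a) =
      tensor_op Q m Y (\<lambda>b. v (n + b)) a"
    by (simp add: tensor_op_def sum_lessThan_add)
qed

text \<open>\<open>Q(X \<oplus> Y)\<close> is the orthogonal direct sum of \<open>Q(X)\<close> and \<open>Q(Y)\<close>, so its norm is the larger of the two
  norms. Evaluating a function at a direct sum requires this membership, since functions carry no
  information outside the ball.\<close>
lemma nc_ball_level_dsum:
  fixes Q :: "'d::finite \<Rightarrow> 'h \<Rightarrow> 'h::complex_hilbert_space"
  assumes Q: "\<forall>j. Q j \<in> bounded_operators"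
    and X: "X \<in> nc_ball_level Q n" and Y: "Y \<in> nc_ball_level Q m"
  shows "(\<lambda>j. dsum (X j) (Y j)) \<in> nc_ball_level Q (n + m)"
proof -
  let ?Z = "\<lambda>j. dsum (X j) (Y j)"
  have XY: "X \<in> tuples n" "Y \<in> tuples m" "tensor_op_norm Q n X < 1" "tensor_op_norm Q m Y < 1"
    using X Y by (auto simp: nc_ball_level_def)
  define c where "c = max (tensor_op_norm Q n X) (tensor_op_norm Q m Y)"
  have c: "0 \<le> c" "c < 1" using XY tensor_op_norm_nonneg[OF Q, of n X] by (auto simp: c_def)
  have "tensor_op_norm Q (n + m) ?Z \<le> c"
    unfolding tensor_op_norm_def[of Q "n + m"]
  proof (rule cSUP_least)
    have "(\<lambda>_. 0::'h) \<in> {v. tuple_norm (n + m) v \<le> 1}" by (simp add: L2_set_0')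
    then show "{v::nat \<Rightarrow> 'h. tuple_norm (n + m) v \<le> 1} \<noteq> {}" by (metis empty_iff)
    fix v :: "nat \<Rightarrow> 'h" assume v: "v \<in> {v. tuple_norm (n + m) v \<le> 1}"
    let ?w = "\<lambda>b. v (n + b)"
    have 1: "tuple_norm n (tensor_op Q n X v) \<le> c * tuple_norm n v"
      using tensor_op_le[OF Q, of n X v] by (rule order_trans) (simp add: c_def mult_right_mono)
    have 2: "tuple_norm m (tensor_op Q m Y ?w) \<le> c * tuple_norm m ?w"
      using tensor_op_le[OF Q, of m Y ?w] by (rule order_trans) (simp add: c_def mult_right_mono)
    have "(tuple_norm (n + m) (tensor_op Q (n + m) ?Z v))\<^sup>2 =
        (tuple_norm n (tensor_op Q n X v))\<^sup>2 + (tuple_norm m (tensor_op Q m Y ?w))\<^sup>2"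
      unfolding L2_set_lessThan_add
      using tensor_op_dsum[OF XY(1,2), where Q = Q and v = v] by (auto intro!: arg_cong2[where f = "(+)"] L2_set_cong)
    also have "\<dots> \<le> (c * tuple_norm n v)\<^sup>2 + (c * tuple_norm m ?w)\<^sup>2"
      by (intro add_mono power_mono 1 2) auto
    also have "\<dots> = (c * tuple_norm (n + m) v)\<^sup>2"
      by (simp add: power_mult_distrib L2_set_lessThan_add distrib_left)
    finally have "tuple_norm (n + m) (tensor_op Q (n + m) ?Z v) \<le> c * tuple_norm (n + m) v"
      using c by (rule_tac power2_le_imp_le) auto
    also have "\<dots> \<le> c" using v c by (auto intro: mult_left_le)
    finally show "tuple_norm (n + m) (tensor_op Q (n + m) ?Z v) \<le> c" .
  qed
  moreover have "?Z \<in> tuples (n + m)" using XY by (simp add: tuples_def)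
  ultimately show ?thesis using c by (simp add: nc_ball_level_def)
qed

text \<open>Suprema over the ball need it to be nonempty.\<close>
lemma zero_in_nc_ball:
  fixes Q :: "'d::finite \<Rightarrow> 'h \<Rightarrow> 'h::complex_hilbert_space"
  shows "(\<lambda>_. 0\<^sub>m 1 1) \<in> nc_ball Q"
proof -
  have "tensor_op Q 1 (\<lambda>_. 0\<^sub>m 1 1) v 0 = 0" for v :: "nat \<Rightarrow> 'h"
    by (simp add: tensor_op_def)
  then have "tensor_op_norm Q 1 (\<lambda>_. 0\<^sub>m 1 1) = (SUP v\<in>{v::nat \<Rightarrow> 'h. tuple_norm 1 v \<le> 1}. 0)"
    unfolding tensor_op_norm_def by (simp add: lessThan_Suc)
  also have "\<dots> = 0"
  proof (rule cSUP_const)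
    have "(\<lambda>_. 0::'h) \<in> {v. tuple_norm 1 v \<le> 1}" by (simp add: L2_set_0')
    then show "{v::nat \<Rightarrow> 'h. tuple_norm 1 v \<le> 1} \<noteq> {}" by (metis empty_iff)
  qed
  finally have "(\<lambda>_. 0\<^sub>m 1 1) \<in> nc_ball_level Q 1"
    by (simp add: nc_ball_level_def tuples_def)
  then show ?thesis unfolding nc_ball_def by blast
qed

section \<open>NC functions as functions commuting with intertwiners\<close>

lemma nc_ball_levelD:
  assumes "X \<in> nc_ball_level Q n" "1 \<le> n"
  shows "X \<in> nc_ball Q" "level X = n" "X j \<in> carrier_mat n n"
  using assms level_eq by (auto simp: nc_ball_def nc_ball_level_def tuples_def)

text \<open>The isometries of \<open>\<complex>\<^sup>n\<close> and \<open>\<complex>\<^sup>m\<close> onto the two summands of \<open>\<complex>\<^sup>n\<^sup>+\<^sup>m\<close>.\<close>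
definition incl_left :: "nat \<Rightarrow> nat \<Rightarrow> complex mat" where
  "incl_left n m = mat (n + m) n (\<lambda>(a, b). if a = b then 1 else 0)"

definition incl_right :: "nat \<Rightarrow> nat \<Rightarrow> complex mat" where
  "incl_right n m = mat (n + m) m (\<lambda>(a, b). if a = n + b then 1 else 0)"

lemma incl_carrier [simp]:
  "incl_left n m \<in> carrier_mat (n + m) n" "incl_right n m \<in> carrier_mat (n + m) m"
  by (simp_all add: incl_left_def incl_right_def)

text \<open>The ranges of the two isometries span the whole space, so a matrix is determined by its products
  with them; these are its left and right block columns.\<close>
lemma eq_dsum_iff:
  assumes Z: "Z \<in> carrier_mat (n + m) (n + m)"
    and A: "A \<in> carrier_mat n n" and B: "B \<in> carrier_mat m m"
  shows "Z = dsum A B \<longleftrightarrow>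
    Z * incl_left n m = incl_left n m * A \<and> Z * incl_right n m = incl_right n m * B"
proof -
  have ZL: "(Z * incl_left n m) $$ (a, b) = Z $$ (a, b)" if "a < n + m" "b < n" for a b
  proof -
    have "(Z * incl_left n m) $$ (a, b) = (\<Sum>t<n + m. Z $$ (a, t) * incl_left n m $$ (t, b))"
      by (rule index_mult_mat_sum[OF Z incl_carrier(1) that])
    also have "\<dots> = (\<Sum>t<n + m. if t = b then Z $$ (a, t) else 0)"
      using that by (intro sum.cong refl) (simp add: incl_left_def)
    finally show ?thesis using that by simp
  qed
  have ZR: "(Z * incl_right n m) $$ (a, b) = Z $$ (a, n + b)" if "a < n + m" "b < m" for a b
  proof -
    have "(Z * incl_right n m) $$ (a, b) = (\<Sum>t<n + m. Z $$ (a, t) * incl_right n m $$ (t, b))"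
      by (rule index_mult_mat_sum[OF Z incl_carrier(2) that])
    also have "\<dots> = (\<Sum>t<n + m. if t = n + b then Z $$ (a, t) else 0)"
      using that by (intro sum.cong refl) (simp add: incl_right_def)
    finally show ?thesis using that by simp
  qed
  have LA: "(incl_left n m * A) $$ (a, b) = (if a < n then A $$ (a, b) else 0)"
    if "a < n + m" "b < n" for a b
  proof -
    have "(incl_left n m * A) $$ (a, b) = (\<Sum>t<n. incl_left n m $$ (a, t) * A $$ (t, b))"
      by (rule index_mult_mat_sum[OF incl_carrier(1) A that])
    also have "\<dots> = (\<Sum>t<n. if t = a then A $$ (t, b) else 0)"
      using that by (intro sum.cong refl) (simp add: incl_left_def)
    finally show ?thesis using that by simp
  qed
  have RB: "(incl_right n m * B) $$ (a, b) = (if a < n then 0 else B $$ (a - n, b))"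
    if "a < n + m" "b < m" for a b
  proof -
    have "(incl_right n m * B) $$ (a, b) = (\<Sum>t<m. incl_right n m $$ (a, t) * B $$ (t, b))"
      by (rule index_mult_mat_sum[OF incl_carrier(2) B that])
    also have "\<dots> = (\<Sum>t<m. if a = n + t then B $$ (t, b) else 0)"
      using that by (intro sum.cong refl) (simp add: incl_right_def)
    also have "\<dots> = (\<Sum>t<m. if n \<le> a \<and> t = a - n then B $$ (t, b) else 0)"
      by (intro sum.cong) auto
    finally show ?thesis using that by (cases "a < n") auto
  qed
  show ?thesis
  proof
    assume "Z = dsum A B"
    then have "Z $$ (a, b) = dsum A B $$ (a, b)" for a b by simp
    then show "Z * incl_left n m = incl_left n m * A \<and> Z * incl_right n m = incl_right n m * B"
      using Z A B
      by (auto intro!: eq_matI simp: ZL ZR LA RB index_dsum[OF A B] simp del: index_mult_mat(1)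
            simp: incl_left_def[THEN arg_cong, of dim_row] incl_left_def[THEN arg_cong, of dim_col]
              incl_right_def[THEN arg_cong, of dim_row] incl_right_def[THEN arg_cong, of dim_col])
  next
    assume *: "Z * incl_left n m = incl_left n m * A \<and> Z * incl_right n m = incl_right n m * B"
    show "Z = dsum A B"
    proof (rule eq_matI)
      fix a b assume "a < dim_row (dsum A B)" "b < dim_col (dsum A B)"
      then have ab: "a < n + m" "b < n + m" using A B by (auto simp: dsum_def)
      show "Z $$ (a, b) = dsum A B $$ (a, b)"
      proof (cases "b < n")
        case True
        then have "Z $$ (a, b) = (if a < n then A $$ (a, b) else 0)"
          using ZL[OF ab(1) True] LA[OF ab(1) True] * by simp
        then show ?thesis using True by (auto simp: index_dsum[OF A B ab])
      next
        case False
        then have b: "b - n < m" "n + (b - n) = b" using ab by auto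
        then have "Z $$ (a, b) = (if a < n then 0 else B $$ (a - n, b - n))"
          using ZR[OF ab(1) b(1)] RB[OF ab(1) b(1)] * by simp
        then show ?thesis using False by (auto simp: index_dsum[OF A B ab])
      qed
    qed (use Z A B in \<open>auto simp: dsum_def\<close>)
  qed
qed

text \<open>The instances of \<open>X'\<^sub>j T = T X\<^sub>j\<close> that encode the axioms of an NC function. Restricting \<open>T\<close> to these
  three shapes keeps the equivalence below elementary; for arbitrary \<open>T\<close> one would have to rescale
  matrix tuples to stay inside the ball.\<close>
inductive nc_intertwiner ::
  "('d::finite \<Rightarrow> 'h \<Rightarrow> 'h::complex_hilbert_space) \<Rightarrow> 'd mtuple \<Rightarrow> complex mat \<Rightarrow> 'd mtuple \<Rightarrow> bool"
  for Q where
  left: "1 \<le> n \<Longrightarrow> 1 \<le> m \<Longrightarrow> X \<in> nc_ball_level Q n \<Longrightarrow> Y \<in> nc_ball_level Q m \<Longrightarrow>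
    nc_intertwiner Q (\<lambda>j. dsum (X j) (Y j)) (incl_left n m) X"
| right: "1 \<le> n \<Longrightarrow> 1 \<le> m \<Longrightarrow> X \<in> nc_ball_level Q n \<Longrightarrow> Y \<in> nc_ball_level Q m \<Longrightarrow>
    nc_intertwiner Q (\<lambda>j. dsum (X j) (Y j)) (incl_right n m) Y"
| similar: "1 \<le> n \<Longrightarrow> X \<in> nc_ball_level Q n \<Longrightarrow> S \<in> carrier_mat n n \<Longrightarrow> S' \<in> carrier_mat n n \<Longrightarrow>
    S * S' = 1\<^sub>m n \<Longrightarrow> S' * S = 1\<^sub>m n \<Longrightarrow> (\<lambda>j. S' * X j * S) \<in> nc_ball_level Q n \<Longrightarrow>
    nc_intertwiner Q X S (\<lambda>j. S' * X j * S)"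

lemma nc_intertwiner_carrier:
  assumes Q: "\<forall>j. Q j \<in> bounded_operators" and "nc_intertwiner Q X' T X"
  shows "X' \<in> nc_ball Q \<and> X \<in> nc_ball Q \<and> T \<in> carrier_mat (level X') (level X)"
  using assms(2)
proof cases
  case (left n m Y)
  have "X' \<in> nc_ball_level Q (n + m)" unfolding left by (rule nc_ball_level_dsum[OF Q left(5,6)])
  then show ?thesis using left nc_ball_levelD by (metis incl_carrier(1) trans_le_add1)
next
  case (right n m X)
  have "X' \<in> nc_ball_level Q (n + m)" unfolding right by (rule nc_ball_level_dsum[OF Q right(5,6)])
  then show ?thesis using right nc_ball_levelD by (metis incl_carrier(2) trans_le_add1)
next
  case (similar n S')
  then show ?thesis using nc_ball_levelD by metis
qed

lemma similarity_iff_intertwining: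
  fixes A B S S' :: "complex mat"
  assumes "A \<in> carrier_mat n n" "B \<in> carrier_mat n n" "S \<in> carrier_mat n n" "S' \<in> carrier_mat n n"
    and inv: "S * S' = 1\<^sub>m n" "S' * S = 1\<^sub>m n"
  shows "B = S' * A * S \<longleftrightarrow> A * S = S * B"
proof
  assume "B = S' * A * S"
  then have "S * B = (S * S') * (A * S)"
    using assms(1-4) by (simp add: assoc_mult_mat[of _ n n _ n _ n])
  then show "A * S = S * B"
    by (simp add: inv left_mult_one_mat[OF mult_carrier_mat[OF assms(1,3)]])
next
  assume "A * S = S * B"
  then have "S' * A * S = (S' * S) * B"
    using assms(1-4) by (simp add: assoc_mult_mat[of _ n n _ n _ n])
  then show "B = S' * A * S" using inv assms by simp
qed

text \<open>Direct sums correspond to the two inclusions by \<open>eq_dsum_iff\<close>, similarities to the invertible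
  intertwiners by \<open>similarity_iff_intertwining\<close>.\<close>
lemma nc_function_iff_intertwining:
  assumes Q: "\<forall>j. Q j \<in> bounded_operators"
  shows "nc_function Q f \<longleftrightarrow>
    f \<in> extensional (nc_ball Q) \<and>
    (\<forall>X\<in>nc_ball Q. f X \<in> carrier_mat (level X) (level X)) \<and>
    (\<forall>X' T X. nc_intertwiner Q X' T X \<longrightarrow> f X' * T = T * f X)" (is "?L \<longleftrightarrow> ?R")
proof
  assume L: ?L
  have carr: "f X \<in> carrier_mat (level X) (level X)" if "X \<in> nc_ball Q" for X
    using L that unfolding nc_function_def by (metis nc_ballE)
  have "f X' * T = T * f X" if "nc_intertwiner Q X' T X" for X' T X
    using that
  proof cases
    case (left n m Y)
    note b = nc_ball_levelD[OF left(5,3)] nc_ball_levelD[OF left(6,4)]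
    have "f X' = dsum (f X) (f Y)"
      using L b unfolding nc_function_def left(1) by blast
    moreover have "f X \<in> carrier_mat n n" "f Y \<in> carrier_mat m m" using carr b by auto
    ultimately show ?thesis using left(2) eq_dsum_iff dsum_carrier by metis
  next
    case (right n m Y)
    note b = nc_ball_levelD[OF right(5,3)] nc_ball_levelD[OF right(6,4)]
    have "f X' = dsum (f Y) (f X)"
      using L b unfolding nc_function_def right(1) by blast
    moreover have "f X \<in> carrier_mat m m" "f Y \<in> carrier_mat n n" using carr b by auto
    ultimately show ?thesis using right(2) eq_dsum_iff dsum_carrier by metis
  next
    case (similar n S')
    have "\<forall>n\<ge>1. \<forall>X\<in>nc_ball_level Q n. \<forall>S\<in>carrier_mat n n. \<forall>S'\<in>carrier_mat n n.
        S * S' = 1\<^sub>m n \<longrightarrow> S' * S = 1\<^sub>m n \<longrightarrow> (\<lambda>j. S' * X j * S) \<in> nc_ball_level Q n \<longrightarrow>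
        f (\<lambda>j. S' * X j * S) = S' * f X * S"
      using L unfolding nc_function_def by (elim conjE)
    from this[rule_format, OF similar(2-8)] have "f X = S' * f X' * T"
      by (simp only: similar(1))
    moreover have X: "X \<in> nc_ball_level Q n" using similar(8) by (simp only: similar(1))
    have "f X \<in> carrier_mat n n" "f X' \<in> carrier_mat n n"
      using carr[of X] carr[of X'] nc_ball_levelD(1,2)[OF similar(3,2)]
        nc_ball_levelD(1,2)[OF X similar(2)] by auto
    ultimately show ?thesis
      using similarity_iff_intertwining[OF _ _ similar(4-7)] by blast
  qed
  then show ?R using L carr unfolding nc_function_def by blast
next
  assume R: ?R
  have carr: "f X \<in> carrier_mat n n" if "X \<in> nc_ball_level Q n" "1 \<le> n" for X n
    using R nc_ball_levelD[OF that] by metis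
  have "f (\<lambda>j. dsum (X j) (Y j)) = dsum (f X) (f Y)" if XY: "X \<in> nc_ball Q" "Y \<in> nc_ball Q" for X Y
  proof -
    obtain n where n: "1 \<le> n" "X \<in> nc_ball_level Q n" using nc_ballE[OF XY(1)] .
    obtain m where m: "1 \<le> m" "Y \<in> nc_ball_level Q m" using nc_ballE[OF XY(2)] .
    have "f (\<lambda>j. dsum (X j) (Y j)) \<in> carrier_mat (n + m) (n + m)"
      using n by (intro carr nc_ball_level_dsum[OF Q n(2) m(2)]) simp
    moreover have "f (\<lambda>j. dsum (X j) (Y j)) * incl_left n m = incl_left n m * f X"
      using R nc_intertwiner.left[OF n(1) m(1) n(2) m(2)] by blast
    moreover have "f (\<lambda>j. dsum (X j) (Y j)) * incl_right n m = incl_right n m * f Y"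
      using R nc_intertwiner.right[OF n(1) m(1) n(2) m(2)] by blast
    ultimately show ?thesis
      using eq_dsum_iff[OF _ carr[OF n(2,1)] carr[OF m(2,1)]] by blast
  qed
  moreover have "f (\<lambda>j. S' * X j * S) = S' * f X * S"
    if "1 \<le> n" "X \<in> nc_ball_level Q n" "S \<in> carrier_mat n n" "S' \<in> carrier_mat n n"
      "S * S' = 1\<^sub>m n" "S' * S = 1\<^sub>m n" "(\<lambda>j. S' * X j * S) \<in> nc_ball_level Q n" for n X S S'
    using R nc_intertwiner.similar[OF that] carr that
      similarity_iff_intertwining[OF carr[OF that(2,1)] carr[OF that(7,1)] that(3-6)] by blast
  ultimately show ?L using R carr unfolding nc_function_def by blast
qed

text \<open>The functions \<open>X \<mapsto> F(X)\<close> that come from elements of \<open>M\<^sub>k(H\<^sup>\<infinity>)\<close>, described without reference to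
  the entries of \<open>F\<close>.\<close>
definition nc_matfun ::
  "nat \<Rightarrow> ('d::finite \<Rightarrow> 'h \<Rightarrow> 'h::complex_hilbert_space) \<Rightarrow> ('d mtuple \<Rightarrow> complex mat) \<Rightarrow> bool" where
  "nc_matfun k Q M \<longleftrightarrow>
     (\<forall>X\<in>nc_ball Q. M X \<in> carrier_mat (k * level X) (k * level X)) \<and>
     (\<forall>X' T X. nc_intertwiner Q X' T X \<longrightarrow> M X' * amp k T = amp k T * M X) \<and>
     (\<exists>C. \<forall>X\<in>nc_ball Q. mat_norm (M X) \<le> C)"

lemma nc_matfun_carrier:
  "nc_matfun k Q M \<Longrightarrow> X \<in> nc_ball Q \<Longrightarrow> M X \<in> carrier_mat (k * level X) (k * level X)"
  by (simp add: nc_matfun_def)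

lemma mat_eval_carrier:
  "F \<in> mat_hinf k Q \<Longrightarrow> mat_eval F X \<in> carrier_mat (k * level X) (k * level X)"
  by (auto simp: mat_hinf_def mat_eval_def Let_def)

lemma block_mat_eval:
  assumes "F \<in> mat_hinf k Q" "X \<in> nc_ball Q" "i < k" "j < k"
  shows "block (level X) i j (mat_eval F X) = (F $$ (i, j)) X"
  using mat_hinf_entry_carrier[OF assms(1,3,4,2)] assms
  by (intro eq_matI) (auto simp: block_def mat_eval_def Let_def block_index_less mat_hinf_def)

lemma hinfE:
  assumes "f \<in> hinf Q"
  obtains C where "\<And>X. X \<in> nc_ball Q \<Longrightarrow> mat_norm (f X) \<le> C"
  using assms unfolding hinf_def bdd_above_def by auto

lemma nc_matfun_mat_eval:
  assumes Q: "\<forall>j. Q j \<in> bounded_operators" and F: "F \<in> mat_hinf k Q"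
  shows "nc_matfun k Q (mat_eval F)"
  unfolding nc_matfun_def
proof (intro conjI ballI allI impI)
  have entry: "F $$ (i, j) \<in> hinf Q" if "i < k" "j < k" for i j
    using F that by (simp add: mat_hinf_def)
  show carr: "mat_eval F X \<in> carrier_mat (k * level X) (k * level X)" for X
    by (rule mat_eval_carrier[OF F])
  show "mat_eval F X' * amp k T = amp k T * mat_eval F X" if T: "nc_intertwiner Q X' T X" for X' T X
  proof -
    have *: "X' \<in> nc_ball Q" "X \<in> nc_ball Q" "T \<in> carrier_mat (level X') (level X)"
      using nc_intertwiner_carrier[OF Q T] by auto
    have "(F $$ (i, j)) X' * T = T * (F $$ (i, j)) X" if "i < k" "j < k" for i j
      using entry[OF that] T unfolding hinf_def nc_function_iff_intertwining[OF Q] by blast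
    then show ?thesis
      by (simp add: amp_intertwines_iff[OF carr *(3) carr] block_mat_eval[OF F] *)
  qed
  have "\<exists>C. \<forall>X\<in>nc_ball Q. mat_norm ((F $$ (i, j)) X) \<le> C" if "i < k" "j < k" for i j
    using hinfE[OF entry[OF that]] by metis
  then obtain C where C: "\<And>i j X. i < k \<Longrightarrow> j < k \<Longrightarrow> X \<in> nc_ball Q \<Longrightarrow> mat_norm ((F $$ (i, j)) X) \<le> C i j"
    by metis
  show "\<exists>C. \<forall>X\<in>nc_ball Q. mat_norm (mat_eval F X) \<le> C"
  proof (intro exI ballI)
    fix X assume X: "X \<in> nc_ball Q"
    have "mat_norm (mat_eval F X) \<le> (\<Sum>i<k. \<Sum>j<k. mat_norm (block (level X) i j (mat_eval F X)))"
      by (rule mat_norm_le_sum_blocks[OF carr])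
    also have "\<dots> \<le> (\<Sum>i<k. \<Sum>j<k. C i j)"
      by (intro sum_mono) (simp add: block_mat_eval[OF F X] C[OF _ _ X])
    finally show "mat_norm (mat_eval F X) \<le> (\<Sum>i<k. \<Sum>j<k. C i j)" .
  qed
qed

lemma mat_hinf_of_nc_matfun:
  assumes Q: "\<forall>j. Q j \<in> bounded_operators" and M: "nc_matfun k Q M"
  obtains F where "F \<in> mat_hinf k Q" "\<And>X. X \<in> nc_ball Q \<Longrightarrow> mat_eval F X = M X"
proof -
  define F where "F = mat k k (\<lambda>(i, j). \<lambda>X\<in>nc_ball Q. block (level X) i j (M X))"
  obtain C where C: "\<And>X. X \<in> nc_ball Q \<Longrightarrow> mat_norm (M X) \<le> C"
    using M unfolding nc_matfun_def by blast
  note carr = nc_matfun_carrier[OF M]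
  have "F $$ (i, j) \<in> hinf Q" if ij: "i < k" "j < k" for i j
  proof -
    have eval: "(F $$ (i, j)) X = block (level X) i j (M X)" if "X \<in> nc_ball Q" for X
      using ij that by (simp add: F_def)
    have "(F $$ (i, j)) X' * T = T * (F $$ (i, j)) X" if T: "nc_intertwiner Q X' T X" for X' T X
    proof -
      have *: "X' \<in> nc_ball Q" "X \<in> nc_ball Q" "T \<in> carrier_mat (level X') (level X)"
        using nc_intertwiner_carrier[OF Q T] by auto
      have "M X' * amp k T = amp k T * M X" using M T unfolding nc_matfun_def by blast
      then show ?thesis
        using ij by (simp add: eval * amp_intertwines_iff[OF carr[OF *(1)] *(3) carr[OF *(2)]])
    qed
    moreover have "F $$ (i, j) \<in> extensional (nc_ball Q)" using ij by (simp add: F_def)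
    moreover have "mat_norm ((F $$ (i, j)) X) \<le> C" if "X \<in> nc_ball Q" for X
      using mat_norm_block[OF carr[OF that] ij] C[OF that] eval[OF that] by simp
    ultimately show ?thesis
      unfolding hinf_def nc_function_iff_intertwining[OF Q] by (auto simp: eval intro: bdd_aboveI2[of _ _ C])
  qed
  then have F: "F \<in> mat_hinf k Q" by (simp add: mat_hinf_def F_def)
  moreover have "mat_eval F X = M X" if X: "X \<in> nc_ball Q" for X
  proof (rule block_eqI[OF mat_eval_carrier[OF F] carr[OF X]])
    fix i j assume "i < k" "j < k"
    then show "block (level X) i j (mat_eval F X) = block (level X) i j (M X)"
      using X by (simp add: block_mat_eval[OF F X]) (simp add: F_def)
  qed
  ultimately show ?thesis using that by blast
qed

lemma nc_matfun_mult:
  assumes Q: "\<forall>j. Q j \<in> bounded_operators" and M: "nc_matfun k Q M" and N: "nc_matfun k Q N"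
  shows "nc_matfun k Q (\<lambda>X. M X * N X)"
  unfolding nc_matfun_def
proof (intro conjI ballI allI impI)
  note carr = nc_matfun_carrier[OF M] nc_matfun_carrier[OF N]
  show "M X * N X \<in> carrier_mat (k * level X) (k * level X)" if "X \<in> nc_ball Q" for X
    using carr[OF that] by (rule mult_carrier_mat)
  show "M X' * N X' * amp k T = amp k T * (M X * N X)" if T: "nc_intertwiner Q X' T X" for X' T X
  proof -
    have *: "X' \<in> nc_ball Q" "X \<in> nc_ball Q" "T \<in> carrier_mat (level X') (level X)"
      using nc_intertwiner_carrier[OF Q T] by auto
    note c = carr(1)[OF *(1)] carr(2)[OF *(1)] carr(1)[OF *(2)] carr(2)[OF *(2)]
      amp_carrier[OF *(3), of k]
    have int: "M X' * amp k T = amp k T * M X" "N X' * amp k T = amp k T * N X"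
      using M N T unfolding nc_matfun_def by blast+
    have "M X' * N X' * amp k T = M X' * (amp k T * N X)"
      unfolding int(2)[symmetric] by (rule assoc_mult_mat[OF c(1,2,5)])
    also have "\<dots> = amp k T * M X * N X"
      unfolding int(1)[symmetric] by (rule assoc_mult_mat[OF c(1,5,4), symmetric])
    also have "\<dots> = amp k T * (M X * N X)"
      by (rule assoc_mult_mat[OF c(5,3,4)])
    finally show ?thesis .
  qed
  obtain C D where C: "\<And>X. X \<in> nc_ball Q \<Longrightarrow> mat_norm (M X) \<le> C"
    and D: "\<And>X. X \<in> nc_ball Q \<Longrightarrow> mat_norm (N X) \<le> D"
    using M N unfolding nc_matfun_def by metis
  show "\<exists>C. \<forall>X\<in>nc_ball Q. mat_norm (M X * N X) \<le> C"
  proof (intro exI ballI)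
    fix X assume X: "X \<in> nc_ball Q"
    have "mat_norm (M X * N X) \<le> mat_norm (M X) * mat_norm (N X)"
      by (rule mat_norm_mult[OF carr(1)[OF X] carr(2)[OF X]])
    also have "\<dots> \<le> C * D"
      by (intro mult_mono C D X mat_norm_nonneg order_trans[OF mat_norm_nonneg C[OF X]])
    finally show "mat_norm (M X * N X) \<le> C * D" .
  qed
qed

text \<open>Multiplying \<open>M(X') T = T M(X)\<close> by the inverses from both sides gives \<open>T R(X) = R(X') T\<close>. Only the
  uniform bound on the inverses has to be supplied from outside.\<close>
lemma nc_matfun_inverse:
  assumes Q: "\<forall>j. Q j \<in> bounded_operators" and M: "nc_matfun k Q M"
    and R: "\<And>X. X \<in> nc_ball Q \<Longrightarrow> R X \<in> carrier_mat (k * level X) (k * level X)"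
    and bounded: "\<And>X. X \<in> nc_ball Q \<Longrightarrow> mat_norm (R X) \<le> C"
    and MR: "\<And>X. X \<in> nc_ball Q \<Longrightarrow> M X * R X = 1\<^sub>m (k * level X)"
    and RM: "\<And>X. X \<in> nc_ball Q \<Longrightarrow> R X * M X = 1\<^sub>m (k * level X)"
  shows "nc_matfun k Q R"
  unfolding nc_matfun_def
proof (intro conjI ballI allI impI)
  show "R X' * amp k T = amp k T * R X" if T: "nc_intertwiner Q X' T X" for X' T X
  proof -
    have *: "X' \<in> nc_ball Q" "X \<in> nc_ball Q" "T \<in> carrier_mat (level X') (level X)"
      using nc_intertwiner_carrier[OF Q T] by auto
    note c = R[OF *(1)] R[OF *(2)] nc_matfun_carrier[OF M *(1)] nc_matfun_carrier[OF M *(2)]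
      amp_carrier[OF *(3), of k]
    have int: "M X' * amp k T = amp k T * M X"
      using M T unfolding nc_matfun_def by blast
    have "R X' * amp k T = R X' * (amp k T * M X * R X)"
      using c by (simp add: MR * assoc_mult_mat[OF c(5,4,2)] right_mult_one_mat[OF c(5)])
    also have "\<dots> = R X' * (M X' * (amp k T * R X))"
      unfolding int[symmetric] by (simp only: assoc_mult_mat[OF c(3,5,2)])
    also have "\<dots> = R X' * M X' * (amp k T * R X)"
      using c by (intro assoc_mult_mat[symmetric]) auto
    also have "\<dots> = amp k T * R X"
      by (simp add: RM * left_mult_one_mat[OF mult_carrier_mat[OF c(5,2)]])
    finally show ?thesis .
  qed
qed (use R bounded in auto)

lemma nc_matfun_add_scalar:
  assumes Q: "\<forall>j. Q j \<in> bounded_operators" and M: "nc_matfun k Q M"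
  shows "nc_matfun k Q (\<lambda>X. M X + c \<cdot>\<^sub>m 1\<^sub>m (k * level X))"
  unfolding nc_matfun_def
proof (intro conjI ballI allI impI)
  note carr = nc_matfun_carrier[OF M]
  show "(M X' + c \<cdot>\<^sub>m 1\<^sub>m (k * level X')) * amp k T = amp k T * (M X + c \<cdot>\<^sub>m 1\<^sub>m (k * level X))"
    if T: "nc_intertwiner Q X' T X" for X' T X
  proof -
    have *: "X' \<in> nc_ball Q" "X \<in> nc_ball Q" "T \<in> carrier_mat (level X') (level X)"
      using nc_intertwiner_carrier[OF Q T] by auto
    note cs = carr[OF *(1)] carr[OF *(2)] amp_carrier[OF *(3), of k]
    have "(M X' + c \<cdot>\<^sub>m 1\<^sub>m (k * level X')) * amp k T =
        M X' * amp k T + (c \<cdot>\<^sub>m 1\<^sub>m (k * level X')) * amp k T"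
      by (rule add_mult_distrib_mat[OF cs(1) _ cs(3)]) simp
    also have "M X' * amp k T = amp k T * M X"
      using M T unfolding nc_matfun_def by blast
    also have "(c \<cdot>\<^sub>m 1\<^sub>m (k * level X')) * amp k T = amp k T * (c \<cdot>\<^sub>m 1\<^sub>m (k * level X))"
      by (simp add: mult_smult_distrib[OF cs(3) one_carrier_mat] mult_smult_assoc_mat[OF one_carrier_mat cs(3)]
          left_mult_one_mat[OF cs(3)] right_mult_one_mat[OF cs(3)])
    also have "amp k T * M X + amp k T * (c \<cdot>\<^sub>m 1\<^sub>m (k * level X)) =
        amp k T * (M X + c \<cdot>\<^sub>m 1\<^sub>m (k * level X))"
      by (rule mult_add_distrib_mat[OF cs(3,2), symmetric]) simp
    finally show ?thesis .
  qed
  obtain C where C: "\<And>X. X \<in> nc_ball Q \<Longrightarrow> mat_norm (M X) \<le> C"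
    using M unfolding nc_matfun_def by blast
  show "\<exists>C. \<forall>X\<in>nc_ball Q. mat_norm (M X + c \<cdot>\<^sub>m 1\<^sub>m (k * level X)) \<le> C"
  proof (intro exI ballI)
    fix X assume X: "X \<in> nc_ball Q"
    have "mat_norm (1\<^sub>m (k * level X)) \<le> 1"
      by (rule mat_norm_leI[OF one_carrier_mat]) auto
    then have "cmod c * mat_norm (1\<^sub>m (k * level X)) \<le> cmod c"
      by (simp add: mult_left_le)
    then show "mat_norm (M X + c \<cdot>\<^sub>m 1\<^sub>m (k * level X)) \<le> C + cmod c"
      using mat_norm_add[OF carr[OF X], of "c \<cdot>\<^sub>m 1\<^sub>m (k * level X)"]
        mat_norm_smult[OF one_carrier_mat, of c "k * level X"] C[OF X] by simp
  qed
qed (use nc_matfun_carrier[OF M] in auto)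

text \<open>The pointwise product of the values is realized by some element of \<open>M\<^sub>k(H\<^sup>\<infinity>)\<close>, and comparing
  blocks shows that this element is the given product.\<close>
lemma mat_hinf_mult_closed:
  assumes Q: "\<forall>j. Q j \<in> bounded_operators" and G: "G \<in> mat_hinf k Q" and F: "F \<in> mat_hinf k Q"
  shows "mat_hinf_mult Q G F \<in> mat_hinf k Q"
proof -
  let ?P = "mat_hinf_mult Q G F"
  have dims: "G \<in> carrier_mat k k" "F \<in> carrier_mat k k" using G F by (auto simp: mat_hinf_def)
  have "nc_matfun k Q (\<lambda>X. mat_eval G X * mat_eval F X)"
    by (rule nc_matfun_mult[OF Q nc_matfun_mat_eval[OF Q G] nc_matfun_mat_eval[OF Q F]])
  then obtain A where A: "A \<in> mat_hinf k Q"
    and eval: "\<And>X. X \<in> nc_ball Q \<Longrightarrow> mat_eval A X = mat_eval G X * mat_eval F X"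
    by (rule mat_hinf_of_nc_matfun[OF Q]) blast
  have "?P = A"
  proof (rule eq_matI)
    fix i j assume "i < dim_row A" "j < dim_col A"
    then have ij: "i < k" "j < k" using A by (auto simp: mat_hinf_def)
    have "(?P $$ (i, j)) X = (A $$ (i, j)) X" if X: "X \<in> nc_ball Q" for X
    proof -
      have "(?P $$ (i, j)) X = block (level X) i j (mat_eval ?P X)"
        using ij dims X
        by (intro eq_matI) (auto simp: block_def mat_eval_def Let_def block_index_less mat_hinf_mult_def)
      also have "\<dots> = block (level X) i j (mat_eval A X)"
        by (simp add: eval[OF X] mat_eval_mult[OF G F X])
      finally show ?thesis by (simp add: block_mat_eval[OF A X ij])
    qed
    moreover have "?P $$ (i, j) \<in> extensional (nc_ball Q)"
      using ij dims by (simp add: mat_hinf_mult_def)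
    moreover have "A $$ (i, j) \<in> extensional (nc_ball Q)"
      using A ij by (auto simp: mat_hinf_def hinf_def nc_function_def)
    ultimately show "?P $$ (i, j) = A $$ (i, j)" by (intro extensionalityI) auto
  qed (use A dims in \<open>auto simp: mat_hinf_def mat_hinf_mult_def\<close>)
  then show ?thesis using A by simp
qed

section \<open>Bounded pointwise convergence implies weak-* convergence\<close>

lemma mat_norm_le_hinf_norm:
  assumes "f \<in> hinf Q" "X \<in> nc_ball Q"
  shows "mat_norm (f X) \<le> hinf_norm Q f"
  unfolding hinf_norm_def using assms by (intro cSUP_upper) (auto simp: hinf_def)

lemma hinf_norm_leI:
  assumes "\<And>X. X \<in> nc_ball Q \<Longrightarrow> mat_norm (f X) \<le> C"
  shows "hinf_norm Q f \<le> C"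
  unfolding hinf_norm_def using zero_in_nc_ball[of Q] assms by (intro cSUP_least) auto

lemma hinf_norm_nonneg:
  assumes "f \<in> hinf Q" shows "0 \<le> hinf_norm Q f"
  using mat_norm_le_hinf_norm[OF assms zero_in_nc_ball] mat_norm_nonneg order_trans by blast

lemma hinf_carrier:
  assumes "f \<in> hinf Q" "X \<in> nc_ball Q"
  shows "f X \<in> carrier_mat (level X) (level X)"
  using assms unfolding hinf_def nc_function_def by (metis (no_types, lifting) mem_Collect_eq nc_ballE)

lemma hinf_scale_closed:
  assumes Q: "\<forall>j. Q j \<in> bounded_operators" and f: "f \<in> hinf Q"
  shows "hinf_scale Q c f \<in> hinf Q"
proof -
  note carr = hinf_carrier[OF f]
  have "hinf_scale Q c f X' * T = T * hinf_scale Q c f X" if T: "nc_intertwiner Q X' T X" for X' T X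
  proof -
    have *: "X' \<in> nc_ball Q" "X \<in> nc_ball Q" "T \<in> carrier_mat (level X') (level X)"
      using nc_intertwiner_carrier[OF Q T] by auto
    have "f X' * T = T * f X"
      using f T unfolding hinf_def nc_function_iff_intertwining[OF Q] by blast
    then show ?thesis
      by (simp add: hinf_scale_def * mult_smult_assoc_mat[OF carr[OF *(1)] *(3)]
          mult_smult_distrib[OF *(3) carr[OF *(2)]])
  qed
  moreover have "mat_norm (hinf_scale Q c f X) \<le> cmod c * hinf_norm Q f" if X: "X \<in> nc_ball Q" for X
  proof -
    have "mat_norm (c \<cdot>\<^sub>m f X) \<le> cmod c * mat_norm (f X)" by (rule mat_norm_smult[OF carr[OF X]])
    also have "\<dots> \<le> cmod c * hinf_norm Q f"
      by (intro mult_left_mono mat_norm_le_hinf_norm[OF f X]) simp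
    finally show ?thesis using X by (simp add: hinf_scale_def)
  qed
  ultimately show ?thesis
    unfolding hinf_def nc_function_iff_intertwining[OF Q]
    using carr by (auto simp: hinf_scale_def intro!: bdd_aboveI2)
qed

lemma hinf_add_closed:
  assumes Q: "\<forall>j. Q j \<in> bounded_operators" and f: "f \<in> hinf Q" and g: "g \<in> hinf Q"
  shows "hinf_add Q f g \<in> hinf Q"
proof -
  note carr = hinf_carrier[OF f] hinf_carrier[OF g]
  have "hinf_add Q f g X' * T = T * hinf_add Q f g X" if T: "nc_intertwiner Q X' T X" for X' T X
  proof -
    have *: "X' \<in> nc_ball Q" "X \<in> nc_ball Q" "T \<in> carrier_mat (level X') (level X)"
      using nc_intertwiner_carrier[OF Q T] by auto
    have "f X' * T = T * f X" "g X' * T = T * g X"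
      using f g T unfolding hinf_def nc_function_iff_intertwining[OF Q] by blast+
    then show ?thesis
      by (simp add: hinf_add_def * add_mult_distrib_mat[OF carr(1)[OF *(1)] carr(2)[OF *(1)] *(3)]
          mult_add_distrib_mat[OF *(3) carr(1)[OF *(2)] carr(2)[OF *(2)]])
  qed
  moreover have "mat_norm (hinf_add Q f g X) \<le> hinf_norm Q f + hinf_norm Q g" if X: "X \<in> nc_ball Q" for X
    using mat_norm_add[OF carr(1)[OF X] carr(2)[OF X]] mat_norm_le_hinf_norm[OF f X]
      mat_norm_le_hinf_norm[OF g X] X by (simp add: hinf_add_def)
  ultimately show ?thesis
    unfolding hinf_def nc_function_iff_intertwining[OF Q]
    using carr by (auto simp: hinf_add_def intro!: bdd_aboveI2)
qed

text \<open>Expand a matrix in the matrix units, and bound each coefficient by the operator norm.\<close>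
lemma mat_dual_bounded:
  assumes \<eta>: "\<eta> \<in> mat_dual n"
  obtains K where "0 \<le> K" "\<And>A. A \<in> carrier_mat n n \<Longrightarrow> cmod (\<eta> A) \<le> K * mat_norm A"
proof -
  define E where "E p = mat n n (\<lambda>q. if q = p then 1 else (0::complex))" for p
  define I where "I = {..<n} \<times> {..<n}"
  have add: "\<eta> (A + B) = \<eta> A + \<eta> B" if "A \<in> carrier_mat n n" "B \<in> carrier_mat n n" for A B
    using \<eta> that unfolding mat_dual_def by blast
  have scale: "\<eta> (c \<cdot>\<^sub>m A) = c * \<eta> A" if "A \<in> carrier_mat n n" for A c
    using \<eta> that unfolding mat_dual_def by blast
  have expand: "\<eta> (mat n n (\<lambda>q. if q \<in> S then A $$ q else 0)) = (\<Sum>p\<in>S. A $$ p * \<eta> (E p))"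
    if "finite S" for S A
    using that
  proof (induction S)
    case empty
    have "mat n n (\<lambda>q. if q \<in> {} then A $$ q else 0) = 0 \<cdot>\<^sub>m (0\<^sub>m n n :: complex mat)"
      by (intro eq_matI) auto
    then show ?case by (simp only: scale[OF zero_carrier_mat]) simp
  next
    case (insert p S)
    have "mat n n (\<lambda>q. if q \<in> insert p S then A $$ q else 0) =
        mat n n (\<lambda>q. if q \<in> S then A $$ q else 0) + A $$ p \<cdot>\<^sub>m E p"
      using insert by (intro eq_matI) (auto simp: E_def)
    then have "\<eta> (mat n n (\<lambda>q. if q \<in> insert p S then A $$ q else 0)) =
        \<eta> (mat n n (\<lambda>q. if q \<in> S then A $$ q else 0)) + \<eta> (A $$ p \<cdot>\<^sub>m E p)"
      by (simp only: add[OF mat_carrier smult_carrier_mat] E_def mat_carrier smult_carrier_mat add)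
    also have "\<eta> (A $$ p \<cdot>\<^sub>m E p) = A $$ p * \<eta> (E p)"
      by (rule scale) (simp add: E_def)
    finally show ?case using insert by simp
  qed
  show ?thesis
  proof (rule that[of "\<Sum>p\<in>I. cmod (\<eta> (E p))"])
    fix A :: "complex mat" assume A: "A \<in> carrier_mat n n"
    have "A = mat n n (\<lambda>q. if q \<in> I then A $$ q else 0)"
      using A by (intro eq_matI) (auto simp: I_def)
    then have "\<eta> A = (\<Sum>p\<in>I. A $$ p * \<eta> (E p))"
      using expand[of I A] by (simp add: I_def)
    also have "cmod \<dots> \<le> (\<Sum>p\<in>I. cmod (A $$ p * \<eta> (E p)))" by (rule norm_sum)
    also have "\<dots> \<le> (\<Sum>p\<in>I. mat_norm A * cmod (\<eta> (E p)))"
      using norm_entry_le_mat_norm[OF A]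
      by (intro sum_mono) (auto simp: I_def norm_mult intro!: mult_right_mono)
    finally show "cmod (\<eta> A) \<le> (\<Sum>p\<in>I. cmod (\<eta> (E p))) * mat_norm A"
      by (simp add: sum_distrib_left sum_distrib_right mult.commute)
  qed (simp add: sum_nonneg)
qed

lemma point_functional_bound:
  assumes Q: "\<forall>j. Q j \<in> bounded_operators" and "\<psi> \<in> point_functionals Q"
  shows "\<exists>X K. X \<in> nc_ball Q \<and> 0 \<le> K \<and> (\<forall>f\<in>hinf Q. cmod (\<psi> f) \<le> K * mat_norm (f X)) \<and>
    (\<forall>c. \<forall>f\<in>hinf Q. \<psi> (hinf_scale Q c f) = c * \<psi> f)"
proof -
  obtain n X \<eta> where *: "1 \<le> n" "X \<in> nc_ball_level Q n" "\<eta> \<in> mat_dual n"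
    and \<psi>: "\<psi> = (\<lambda>f\<in>hinf Q. \<eta> (f X))"
    using assms(2) unfolding point_functionals_def by blast
  note X = nc_ball_levelD(1,2)[OF *(2,1)]
  have carr: "f X \<in> carrier_mat n n" if "f \<in> hinf Q" for f
    using hinf_carrier[OF that X(1)] X(2) by simp
  obtain K where K: "0 \<le> K" "\<And>A. A \<in> carrier_mat n n \<Longrightarrow> cmod (\<eta> A) \<le> K * mat_norm A"
    using mat_dual_bounded[OF *(3)] by blast
  have "\<psi> (hinf_scale Q c f) = c * \<psi> f" if "f \<in> hinf Q" for c f
    using *(3) hinf_scale_closed[OF Q that, of c] carr[OF that] X(1) that
    by (simp add: \<psi> hinf_scale_def mat_dual_def)
  then show ?thesis using X K carr by (intro exI[of _ X] exI[of _ K]) (auto simp: \<psi>)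
qed

text \<open>A functional in the span is controlled by the values at finitely many points. This single
  estimate gives both its boundedness and its convergence to zero along pointwise null sequences.\<close>
lemma point_functionals_span_bound:
  assumes Q: "\<forall>j. Q j \<in> bounded_operators" and "\<psi> \<in> point_functionals_span Q"
  obtains m X K where "\<And>i. i < m \<Longrightarrow> X i \<in> nc_ball Q" "\<And>i. i < m \<Longrightarrow> (0::real) \<le> K i"
    "\<And>f. f \<in> hinf Q \<Longrightarrow> cmod (\<psi> f) \<le> (\<Sum>i<(m::nat). K i * mat_norm (f (X i)))"
    "\<And>c f. f \<in> hinf Q \<Longrightarrow> \<psi> (hinf_scale Q c f) = c * \<psi> f"
proof -
  obtain m c \<chi> where \<psi>: "\<psi> = (\<lambda>f\<in>hinf Q. \<Sum>i<(m::nat). c i * \<chi> i f)"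
    and \<chi>: "\<And>i. i < m \<Longrightarrow> \<chi> i \<in> point_functionals Q"
    using assms(2) unfolding point_functionals_span_def by blast
  have "\<forall>i\<in>{..<m}. \<exists>X K. X \<in> nc_ball Q \<and> 0 \<le> K \<and> (\<forall>f\<in>hinf Q. cmod (\<chi> i f) \<le> K * mat_norm (f X)) \<and>
    (\<forall>c. \<forall>f\<in>hinf Q. \<chi> i (hinf_scale Q c f) = c * \<chi> i f)"
    using point_functional_bound[OF Q \<chi>] by blast
  then obtain X K where XK: "\<And>i. i < m \<Longrightarrow> X i \<in> nc_ball Q" "\<And>i. i < m \<Longrightarrow> 0 \<le> K i"
    "\<And>i f. i < m \<Longrightarrow> f \<in> hinf Q \<Longrightarrow> cmod (\<chi> i f) \<le> K i * mat_norm (f (X i))"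
    "\<And>i c f. i < m \<Longrightarrow> f \<in> hinf Q \<Longrightarrow> \<chi> i (hinf_scale Q c f) = c * \<chi> i f"
    unfolding lessThan_iff Ball_def by metis
  show ?thesis
  proof (rule that[of m X "\<lambda>i. cmod (c i) * K i"])
    fix f assume f: "f \<in> hinf Q"
    have "cmod (\<psi> f) \<le> (\<Sum>i<m. cmod (c i * \<chi> i f))"
      using f by (simp add: \<psi> norm_sum)
    also have "\<dots> \<le> (\<Sum>i<m. cmod (c i) * K i * mat_norm (f (X i)))"
      using XK(3)[OF _ f] by (intro sum_mono) (auto simp: norm_mult mult.assoc intro!: mult_left_mono)
    finally show "cmod (\<psi> f) \<le> (\<Sum>i<m. cmod (c i) * K i * mat_norm (f (X i)))" .
    show "\<psi> (hinf_scale Q a f) = a * \<psi> f" for a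
      using f hinf_scale_closed[OF Q f, of a] XK(4)[OF _ f]
      by (simp add: \<psi> sum_distrib_left mult.left_commute)
  qed (use XK in auto)
qed

text \<open>Rescaling \<open>f\<close> into the unit ball. The bound by \<open>K\<close> makes the supremum in \<open>dual_norm\<close> a genuine least
  upper bound.\<close>
lemma le_dual_norm:
  assumes Q: "\<forall>j. Q j \<in> bounded_operators"
    and scale: "\<And>c f. f \<in> hinf Q \<Longrightarrow> \<chi> (hinf_scale Q c f) = c * \<chi> f"
    and bound: "\<And>f. f \<in> hinf Q \<Longrightarrow> cmod (\<chi> f) \<le> K * hinf_norm Q f"
    and f: "f \<in> hinf Q" and C: "0 < C" "\<And>X. X \<in> nc_ball Q \<Longrightarrow> mat_norm (f X) \<le> C"
  shows "cmod (\<chi> f) \<le> C * dual_norm Q \<chi>"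
proof -
  define g where "g = hinf_scale Q (of_real (inverse C)) f"
  have g: "g \<in> hinf Q" unfolding g_def by (rule hinf_scale_closed[OF Q f])
  have "hinf_norm Q g \<le> 1"
  proof (rule hinf_norm_leI)
    fix X assume X: "X \<in> nc_ball Q"
    have "mat_norm (g X) \<le> inverse C * mat_norm (f X)"
      using mat_norm_smult[OF hinf_carrier[OF f X], of "of_real (inverse C)"] X C(1)
      by (simp add: g_def hinf_scale_def norm_inverse)
    also have "\<dots> \<le> inverse C * C"
      using C(1) C(2)[OF X] by (intro mult_left_mono) auto
    finally show "mat_norm (g X) \<le> 1" using C(1) by simp
  qed
  moreover have "bdd_above ((\<lambda>f. cmod (\<chi> f)) ` {f \<in> hinf Q. hinf_norm Q f \<le> 1})"
  proof (rule bdd_aboveI2, safe)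
    fix h assume h: "h \<in> hinf Q" "hinf_norm Q h \<le> 1"
    have "cmod (\<chi> h) \<le> \<bar>K\<bar> * hinf_norm Q h"
      by (rule order_trans[OF bound[OF h(1)] mult_right_mono[OF abs_ge_self hinf_norm_nonneg[OF h(1)]]])
    also have "\<dots> \<le> \<bar>K\<bar>" using h(2) by (intro mult_left_le) auto
    finally show "cmod (\<chi> h) \<le> \<bar>K\<bar>" .
  qed
  ultimately have "cmod (\<chi> g) \<le> dual_norm Q \<chi>"
    unfolding dual_norm_def using g by (intro cSUP_upper) auto
  moreover have "cmod (\<chi> g) = inverse C * cmod (\<chi> f)"
    unfolding g_def scale[OF f] norm_mult norm_of_real using C(1) by simp
  ultimately show ?thesis using C(1) by (simp add: field_simps)
qed

text \<open>Replace \<open>\<phi>\<close> by a functional \<open>\<psi>\<close> in the span, at a cost that is small on the bounded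
  sequence; then \<open>\<psi>\<close> sees only finitely many points, at each of which the sequence tends to \<open>0\<close>.\<close>
lemma predual_tendsto_zero:
  assumes Q: "\<forall>j. Q j \<in> bounded_operators" and \<phi>: "\<phi> \<in> predual Q"
    and f: "\<And>N::nat. f N \<in> hinf Q"
    and bound: "\<And>N X. X \<in> nc_ball Q \<Longrightarrow> mat_norm (f N X) \<le> C"
    and lim: "\<And>X. X \<in> nc_ball Q \<Longrightarrow> (\<lambda>N. mat_norm (f N X)) \<longlonglongrightarrow> 0"
  shows "(\<lambda>N. \<phi> (f N)) \<longlonglongrightarrow> 0"
proof (rule LIMSEQ_I)
  fix r :: real assume r: "0 < r"
  \<comment> \<open>The bound may vanish, but scaling to the unit ball divides by it.\<close>
  define B where "B = max 1 C"
  have B: "0 < B" "\<And>N X. X \<in> nc_ball Q \<Longrightarrow> mat_norm (f N X) \<le> B"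
    using bound by (auto simp: B_def intro: order_trans[OF _ max.cobounded2])
  have "0 < r / (2 * B)" using r B(1) by simp
  then obtain \<psi> where \<psi>: "\<psi> \<in> point_functionals_span Q"
    and close: "dual_norm Q (\<lambda>f\<in>hinf Q. \<phi> f - \<psi> f) < r / (2 * B)"
    using \<phi> unfolding predual_def by blast
  obtain m X K where X: "\<And>i. i < m \<Longrightarrow> X i \<in> nc_ball Q" and K: "\<And>i. i < m \<Longrightarrow> (0::real) \<le> K i"
    and \<psi>_le: "\<And>f. f \<in> hinf Q \<Longrightarrow> cmod (\<psi> f) \<le> (\<Sum>i<(m::nat). K i * mat_norm (f (X i)))"
    and \<psi>_scale: "\<And>c f. f \<in> hinf Q \<Longrightarrow> \<psi> (hinf_scale Q c f) = c * \<psi> f"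
    by (rule point_functionals_span_bound[OF Q \<psi>]) blast
  have \<phi>_dual: "\<phi> \<in> hinf_dual Q" using \<phi> by (simp add: predual_def)
  then obtain L where L: "\<And>f. f \<in> hinf Q \<Longrightarrow> cmod (\<phi> f) \<le> L * hinf_norm Q f"
    unfolding hinf_dual_def by blast
  let ?\<chi> = "\<lambda>f\<in>hinf Q. \<phi> f - \<psi> f"
  have diff: "cmod (\<phi> (f N) - \<psi> (f N)) \<le> B * dual_norm Q ?\<chi>" for N
  proof -
    have "cmod (?\<chi> (f N)) \<le> B * dual_norm Q ?\<chi>"
    proof (rule le_dual_norm[OF Q _ _ f B])
      show "?\<chi> (hinf_scale Q c g) = c * ?\<chi> g" if "g \<in> hinf Q" for c g
        using \<phi>_dual that hinf_scale_closed[OF Q that] \<psi>_scale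
        by (simp add: hinf_dual_def right_diff_distrib)
      show "cmod (?\<chi> g) \<le> (L + (\<Sum>i<m. K i)) * hinf_norm Q g" if g: "g \<in> hinf Q" for g
      proof -
        have "cmod (\<psi> g) \<le> (\<Sum>i<m. K i * hinf_norm Q g)"
          using \<psi>_le[OF g] by (rule order_trans)
            (auto intro!: sum_mono mult_left_mono mat_norm_le_hinf_norm[OF g] X K)
        then have "cmod (\<phi> g) + cmod (\<psi> g) \<le> L * hinf_norm Q g + (\<Sum>i<m. K i) * hinf_norm Q g"
          using L[OF g] by (simp add: sum_distrib_right)
        then show ?thesis
          using g norm_triangle_ineq4[of "\<phi> g" "\<psi> g"] by (simp add: distrib_right)
      qed
    qed
    then show ?thesis using f by simp
  qed
  have small: "B * dual_norm Q ?\<chi> < r / 2"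
    using close B(1) by (simp add: field_simps)
  have "(\<lambda>N. \<Sum>i<m. K i * mat_norm (f N (X i))) \<longlonglongrightarrow> (\<Sum>i<m. K i * 0)"
    using lim X by (intro tendsto_sum tendsto_mult tendsto_const) auto
  then have "(\<lambda>N. \<Sum>i<m. K i * mat_norm (f N (X i))) \<longlonglongrightarrow> 0" by simp
  then obtain N0 where N0: "\<And>N. N \<ge> N0 \<Longrightarrow> \<bar>\<Sum>i<m. K i * mat_norm (f N (X i))\<bar> < r / 2"
    using r LIMSEQ_D[of "\<lambda>N. \<Sum>i<m. K i * mat_norm (f N (X i))" 0 "r / 2"] by auto
  show "\<exists>no. \<forall>N\<ge>no. cmod (\<phi> (f N) - 0) < r"
  proof (intro exI allI impI)
    fix N assume N: "N0 \<le> N"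
    have "cmod (\<psi> (f N)) < r / 2"
      using \<psi>_le[OF f] N0[OF N] by (meson abs_le_D1 order_le_less_trans less_imp_le abs_ge_self)
    moreover have "cmod (\<phi> (f N)) \<le> cmod (\<phi> (f N) - \<psi> (f N)) + cmod (\<psi> (f N))"
      using norm_triangle_ineq[of "\<phi> (f N) - \<psi> (f N)" "\<psi> (f N)"] by simp
    ultimately show "cmod (\<phi> (f N) - 0) < r" using diff[of N] small by simp
  qed
qed

lemma zero_predual:
  assumes Q: "\<forall>j. Q j \<in> bounded_operators"
  shows "(\<lambda>f\<in>hinf Q. 0) \<in> predual Q"
proof -
  let ?z = "\<lambda>f\<in>hinf Q. 0 :: complex"
  have "?z \<in> hinf_dual Q"
    unfolding hinf_dual_def using hinf_add_closed[OF Q] hinf_scale_closed[OF Q]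
    by (auto intro!: exI[of _ 0])
  moreover have "\<exists>\<psi>\<in>point_functionals_span Q. dual_norm Q (\<lambda>f\<in>hinf Q. ?z f - \<psi> f) < \<epsilon>" if "0 < \<epsilon>" for \<epsilon>
  proof (rule bexI[of _ ?z])
    define z where "z = (\<lambda>X\<in>nc_ball Q. 0\<^sub>m (level X) (level X) :: complex mat)"
    have zero_norm: "mat_norm (0\<^sub>m n n) \<le> 0" for n
    proof (rule mat_norm_leI[OF zero_carrier_mat])
      fix v :: "complex vec" assume "v \<in> carrier_vec n"
      then have "0\<^sub>m n n *\<^sub>v v = 0\<^sub>v n" by (intro eq_vecI) (auto simp: scalar_prod_def)
      then show "eucl_norm (0\<^sub>m n n *\<^sub>v v) \<le> 0 * eucl_norm v" by simp
    qed simp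
    have "z X' * T = T * z X" if T: "nc_intertwiner Q X' T X" for X' T X
    proof -
      have *: "X' \<in> nc_ball Q" "X \<in> nc_ball Q" "T \<in> carrier_mat (level X') (level X)"
        using nc_intertwiner_carrier[OF Q T] by auto
      show ?thesis
        by (simp add: z_def * left_mult_zero_mat[OF *(3)] right_mult_zero_mat[OF *(3)])
    qed
    moreover have z_le: "mat_norm (z X) \<le> 0" if "X \<in> nc_ball Q" for X
      using that zero_norm by (simp add: z_def)
    then have "bdd_above ((\<lambda>X. mat_norm (z X)) ` nc_ball Q)" by (rule bdd_aboveI2)
    ultimately have "z \<in> hinf Q"
      unfolding hinf_def nc_function_iff_intertwining[OF Q] by (simp add: z_def)
    moreover have "hinf_norm Q z \<le> 1"
      by (rule hinf_norm_leI) (rule order_trans[OF z_le zero_le_one])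
    ultimately have "{f \<in> hinf Q. hinf_norm Q f \<le> 1} \<noteq> {}" by (metis (mono_tags, lifting) empty_iff mem_Collect_eq)
    then have "(SUP f\<in>{f \<in> hinf Q. hinf_norm Q f \<le> 1}. 0 :: real) = 0" by (rule cSUP_const)
    moreover have "dual_norm Q (\<lambda>f\<in>hinf Q. ?z f - ?z f) = (SUP f\<in>{f \<in> hinf Q. hinf_norm Q f \<le> 1}. 0)"
      unfolding dual_norm_def by (intro SUP_cong) auto
    ultimately have "dual_norm Q (\<lambda>f\<in>hinf Q. ?z f - ?z f) = 0" by (simp only:)
    then show "dual_norm Q (\<lambda>f\<in>hinf Q. ?z f - ?z f) < \<epsilon>" using that by simp
    show "?z \<in> point_functionals_span Q"
      unfolding point_functionals_span_def
      by (intro CollectI exI[of _ "0::nat"]) auto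
  qed
  ultimately show ?thesis unfolding predual_def by blast
qed

text \<open>The subbasic set of the zero functional and the whole plane is all of \<open>M\<^sub>k(H\<^sup>\<infinity>)\<close>. That zero belongs
  to the predual has to be checked, as the closure operator is relative to the topological space.\<close>
lemma topspace_weak_star:
  assumes Q: "\<forall>j. Q j \<in> bounded_operators"
  shows "topspace (weak_star k Q) = mat_hinf k Q"
proof -
  let ?\<Phi> = "\<lambda>F\<in>mat_hinf k Q. \<Sum>i<k. \<Sum>j<k. (\<lambda>f\<in>hinf Q. 0 :: complex) (F $$ (i, j))"
  have "?\<Phi> \<in> mat_predual k Q"
    unfolding mat_predual_def using zero_predual[OF Q]
    by (intro CollectI exI[of _ "\<lambda>i j. \<lambda>f\<in>hinf Q. 0"]) auto
  then have "{F \<in> mat_hinf k Q. ?\<Phi> F \<in> UNIV} \<in> {{F \<in> mat_hinf k Q. \<Phi> F \<in> U} |\<Phi> U. \<Phi> \<in> mat_predual k Q \<and> open U}"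
    using open_UNIV by blast
  then have "mat_hinf k Q \<subseteq> \<Union> {{F \<in> mat_hinf k Q. \<Phi> F \<in> U} |\<Phi> U. \<Phi> \<in> mat_predual k Q \<and> open U}"
    by (intro Union_upper) simp
  then show ?thesis unfolding weak_star_def topology_generated_by_topspace by blast
qed

lemma mat_predual_tendsto:
  assumes Q: "\<forall>j. Q j \<in> bounded_operators" and \<Phi>: "\<Phi> \<in> mat_predual k Q"
    and A: "\<And>N::nat. A N \<in> mat_hinf k Q" and H: "H \<in> mat_hinf k Q"
    and bound: "\<And>N X. X \<in> nc_ball Q \<Longrightarrow> mat_norm (mat_eval (A N) X - mat_eval H X) \<le> C"
    and lim: "\<And>X. X \<in> nc_ball Q \<Longrightarrow> (\<lambda>N. mat_norm (mat_eval (A N) X - mat_eval H X)) \<longlonglongrightarrow> 0"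
  shows "(\<lambda>N. \<Phi> (A N)) \<longlonglongrightarrow> \<Phi> H"
proof -
  obtain \<phi> where \<phi>: "\<And>i j. i < k \<Longrightarrow> j < k \<Longrightarrow> \<phi> i j \<in> predual Q"
    and \<Phi>: "\<Phi> = (\<lambda>F\<in>mat_hinf k Q. \<Sum>i<k. \<Sum>j<k. \<phi> i j (F $$ (i, j)))"
    using \<Phi> unfolding mat_predual_def by blast
  have "(\<lambda>N. \<phi> i j (A N $$ (i, j))) \<longlonglongrightarrow> \<phi> i j (H $$ (i, j))" if ij: "i < k" "j < k" for i j
  proof -
    have AH: "A N $$ (i, j) \<in> hinf Q" "H $$ (i, j) \<in> hinf Q" for N
      using A H ij by (auto simp: mat_hinf_def)
    note H' = hinf_scale_closed[OF Q AH(2), of "- 1"]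
    define f where "f N = hinf_add Q (A N $$ (i, j)) (hinf_scale Q (- 1) (H $$ (i, j)))" for N
    have f: "f N \<in> hinf Q" for N
      unfolding f_def by (rule hinf_add_closed[OF Q AH(1) H'])
    have f_le: "mat_norm (f N X) \<le> mat_norm (mat_eval (A N) X - mat_eval H X)" if X: "X \<in> nc_ball Q" for N X
    proof -
      let ?n = "level X"
      have D: "mat_eval (A N) X - mat_eval H X \<in> carrier_mat (k * ?n) (k * ?n)"
        by (rule minus_carrier_mat) (rule mat_eval_carrier[OF H])
      have "f N X = block ?n i j (mat_eval (A N) X) + (- 1) \<cdot>\<^sub>m block ?n i j (mat_eval H X)"
        using X by (simp add: f_def hinf_add_def hinf_scale_def block_mat_eval[OF A X ij] block_mat_eval[OF H X ij])
      also have "\<dots> = block ?n i j (mat_eval (A N) X - mat_eval H X)"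
        using mat_eval_carrier[OF H, of X] ij by (intro eq_matI) (auto simp: block_def block_index_less)
      finally show ?thesis using mat_norm_block[OF D ij] by simp
    qed
    have "(\<lambda>N. \<phi> i j (f N)) \<longlonglongrightarrow> 0"
    proof (rule predual_tendsto_zero[OF Q \<phi>[OF ij] f])
      show "mat_norm (f N X) \<le> C" if "X \<in> nc_ball Q" for N X
        using f_le[OF that] bound[OF that] order_trans by blast
      show "(\<lambda>N. mat_norm (f N X)) \<longlonglongrightarrow> 0" if "X \<in> nc_ball Q" for X
        by (rule tendsto_sandwich[OF _ _ tendsto_const lim[OF that]])
           (simp_all add: f_le[OF that])
    qed
    moreover have "\<phi> i j (f N) = \<phi> i j (A N $$ (i, j)) - \<phi> i j (H $$ (i, j))" for N
    proof -
      have "\<phi> i j \<in> hinf_dual Q" using \<phi>[OF ij] by (simp add: predual_def)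
      then have "\<phi> i j (f N) = \<phi> i j (A N $$ (i, j)) + (- 1) * \<phi> i j (H $$ (i, j))"
        unfolding f_def hinf_dual_def using AH(1)[of N] AH(2) H' by simp
      then show ?thesis by simp
    qed
    ultimately show ?thesis by (simp add: LIM_zero_iff)
  qed
  then have "(\<lambda>N. \<Sum>i<k. \<Sum>j<k. \<phi> i j (A N $$ (i, j))) \<longlonglongrightarrow> (\<Sum>i<k. \<Sum>j<k. \<phi> i j (H $$ (i, j)))"
    by (intro tendsto_sum) auto
  then show ?thesis using A H by (simp add: \<Phi>)
qed

text \<open>A sequence that is eventually in each subbasic neighbourhood of \<open>H\<close> is eventually in every
  neighbourhood of \<open>H\<close>, by induction on how open sets are generated.\<close>
lemma weak_star_closureI:
  assumes Q: "\<forall>j. Q j \<in> bounded_operators"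
    and S: "\<And>N::nat. A N \<in> S" and A: "\<And>N. A N \<in> mat_hinf k Q" and H: "H \<in> mat_hinf k Q"
    and bound: "\<And>N X. X \<in> nc_ball Q \<Longrightarrow> mat_norm (mat_eval (A N) X - mat_eval H X) \<le> C"
    and lim: "\<And>X. X \<in> nc_ball Q \<Longrightarrow> (\<lambda>N. mat_norm (mat_eval (A N) X - mat_eval H X)) \<longlonglongrightarrow> 0"
  shows "H \<in> weak_star k Q closure_of S"
proof -
  let ?B = "{{F \<in> mat_hinf k Q. \<Phi> F \<in> U} |\<Phi> U. \<Phi> \<in> mat_predual k Q \<and> open U}"
  have "H \<in> U \<Longrightarrow> \<forall>\<^sub>F N in sequentially. A N \<in> U" if "generate_topology_on ?B U" for U
    using that
  proof (induction U)
    case (Int a b)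
    then show ?case by (auto intro: eventually_conj)
  next
    case (UN \<K>)
    then obtain V where V: "V \<in> \<K>" "H \<in> V" by blast
    then have "\<forall>\<^sub>F N in sequentially. A N \<in> V" using UN.IH by blast
    then show ?case by (rule eventually_mono) (use V in blast)
  next
    case (Basis s)
    then obtain \<Phi> U where \<Phi>: "\<Phi> \<in> mat_predual k Q" "open U" and s: "s = {F \<in> mat_hinf k Q. \<Phi> F \<in> U}"
      by blast
    have "(\<lambda>N. \<Phi> (A N)) \<longlonglongrightarrow> \<Phi> H"
      by (rule mat_predual_tendsto[OF Q \<Phi>(1) A H bound lim])
    then have "\<forall>\<^sub>F N in sequentially. \<Phi> (A N) \<in> U"
      using \<Phi>(2) Basis(2) s by (auto dest: topological_tendstoD)
    then show ?case using A by (simp add: s)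
  qed simp
  then have "\<exists>y\<in>S. y \<in> U" if "openin (weak_star k Q) U" "H \<in> U" for U
    using that S eventually_happens'[OF sequentially_bot]
    unfolding weak_star_def openin_topology_generated_by_iff by blast
  then show ?thesis
    using H unfolding in_closure_of topspace_weak_star[OF Q] by blast
qed

section \<open>The resolvent of an accretive matrix\<close>

lemma cscalar_mult_mat_vec:
  assumes "B \<in> carrier_mat n n" "v \<in> carrier_vec n"
  shows "(B *\<^sub>v v) \<bullet>c v = (\<Sum>i<n. \<Sum>j<n. B $$ (i, j) * v $ j * cnj (v $ i))"
proof -
  have "(B *\<^sub>v v) \<bullet>c v = (\<Sum>i<n. (B *\<^sub>v v) $ i * cnj (v $ i))"
    using assms by (auto simp: scalar_prod_def atLeast0LessThan intro!: sum.cong)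
  also have "\<dots> = (\<Sum>i<n. \<Sum>j<n. B $$ (i, j) * v $ j * cnj (v $ i))"
    using assms by (intro sum.cong refl) (simp add: mult_mat_vec_index_sum sum_distrib_right del: index_mult_mat_vec)
  finally show ?thesis .
qed

lemma index_mat_adjoint:
  "A \<in> carrier_mat n n \<Longrightarrow> i < n \<Longrightarrow> j < n \<Longrightarrow> mat_adjoint A $$ (i, j) = cnj (A $$ (j, i))"
  by (auto simp: mat_adjoint_def mat_of_rows_def)

text \<open>The form \<open>\<langle>A\<^sup>* v, v\<rangle>\<close> is the conjugate of \<open>\<langle>A v, v\<rangle>\<close>, so \<open>A\<close> and its hermitian part have the same
  real quadratic form.\<close>
lemma Re_inner_nonneg_of_psd_Re:
  assumes A: "A \<in> carrier_mat n n" and v: "v \<in> carrier_vec n"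
    and psd: "psd ((1/2) \<cdot>\<^sub>m (A + mat_adjoint A))"
  shows "0 \<le> Re ((A *\<^sub>v v) \<bullet>c v)"
proof -
  let ?B = "(1/2) \<cdot>\<^sub>m (A + mat_adjoint A)"
  have adj: "mat_adjoint A \<in> carrier_mat n n" using A by (auto simp: mat_adjoint_def)
  have B: "?B \<in> carrier_mat n n" using A adj by auto
  define s where "s i j = Re (A $$ (i, j) * v $ j * cnj (v $ i))" for i j
  have "Re (?B $$ (i, j) * v $ j * cnj (v $ i)) = (s i j + s j i) / 2" if "i < n" "j < n" for i j
    using that A adj by (simp add: s_def index_mat_adjoint[OF A]) (simp add: algebra_simps)
  then have "Re ((?B *\<^sub>v v) \<bullet>c v) = (\<Sum>i<n. \<Sum>j<n. (s i j + s j i) / 2)"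
    unfolding cscalar_mult_mat_vec[OF B v] Re_sum by (intro sum.cong) auto
  also have "\<dots> = ((\<Sum>i<n. \<Sum>j<n. s i j) + (\<Sum>i<n. \<Sum>j<n. s j i)) / 2"
    by (simp add: sum.distrib sum_divide_distrib[symmetric])
  also have "(\<Sum>i<n. \<Sum>j<n. s j i) = (\<Sum>i<n. \<Sum>j<n. s i j)"
    by (rule sum.swap)
  also have "((\<Sum>i<n. \<Sum>j<n. s i j) + (\<Sum>i<n. \<Sum>j<n. s i j)) / 2 = Re ((A *\<^sub>v v) \<bullet>c v)"
    unfolding cscalar_mult_mat_vec[OF A v] Re_sum s_def by simp
  finally have "Re ((?B *\<^sub>v v) \<bullet>c v) = Re ((A *\<^sub>v v) \<bullet>c v)" .
  moreover have "v \<in> carrier_vec (dim_col ?B)" using B v by (metis carrier_matD(2))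
  then have "0 \<le> Re ((?B *\<^sub>v v) \<bullet>c v)" using psd unfolding psd_def by blast
  ultimately show ?thesis by simp
qed

lemma eucl_norm_add_smult:
  assumes w: "w \<in> carrier_vec n" and v: "v \<in> carrier_vec n"
  shows "(eucl_norm (w + complex_of_real \<epsilon> \<cdot>\<^sub>v v))\<^sup>2 =
    (eucl_norm w)\<^sup>2 + 2 * \<epsilon> * Re (w \<bullet>c v) + \<epsilon>\<^sup>2 * (eucl_norm v)\<^sup>2"
proof -
  have sq: "(eucl_norm x)\<^sup>2 = (\<Sum>i<n. (cmod (x $ i))\<^sup>2)" if "x \<in> carrier_vec n" for x
    using that by (simp add: eucl_norm_def L2_set_def sum_nonneg)
  have "(eucl_norm (w + complex_of_real \<epsilon> \<cdot>\<^sub>v v))\<^sup>2 = (\<Sum>i<n. (cmod (w $ i + of_real \<epsilon> * v $ i))\<^sup>2)"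
    using w v by (simp add: eucl_norm_def L2_set_def sum_nonneg)
  also have "\<dots> = (\<Sum>i<n. (cmod (w $ i))\<^sup>2 + 2 * \<epsilon> * Re (w $ i * cnj (v $ i)) + \<epsilon>\<^sup>2 * (cmod (v $ i))\<^sup>2)"
    by (intro sum.cong refl, simp only: cmod_power2) (simp add: power2_eq_square algebra_simps)
  also have "\<dots> = (\<Sum>i<n. (cmod (w $ i))\<^sup>2) + 2 * \<epsilon> * (\<Sum>i<n. Re (w $ i * cnj (v $ i))) + \<epsilon>\<^sup>2 * (\<Sum>i<n. (cmod (v $ i))\<^sup>2)"
    by (simp only: sum.distrib sum_distrib_left)
  also have "(\<Sum>i<n. Re (w $ i * cnj (v $ i))) = Re (w \<bullet>c v)"
    using v by (simp add: scalar_prod_def atLeast0LessThan)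
  finally show ?thesis by (simp only: sq[OF w] sq[OF v])
qed

text \<open>In \<open>\<parallel>(A + \<epsilon>) v\<parallel>\<^sup>2 = \<parallel>A v\<parallel>\<^sup>2 + 2 \<epsilon> Re \<langle>A v, v\<rangle> + \<epsilon>\<^sup>2 \<parallel>v\<parallel>\<^sup>2\<close> all terms are nonnegative. Dropping all but
  the last gives invertibility and the bound \<open>1/\<epsilon>\<close>, dropping all but the first compares the resolvent
  with the inverse \<open>B\<close> of \<open>A\<close>, uniformly in \<open>\<epsilon>\<close>.\<close>
lemma accretive_resolvent:
  assumes A: "A \<in> carrier_mat n n" and psd: "psd ((1/2) \<cdot>\<^sub>m (A + mat_adjoint A))"
    and B: "B \<in> carrier_mat n n" "B * A = 1\<^sub>m n" and \<epsilon>: "0 < \<epsilon>"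
  defines "A\<epsilon> \<equiv> A + complex_of_real \<epsilon> \<cdot>\<^sub>m 1\<^sub>m n"
  shows "\<exists>R\<in>carrier_mat n n. R * A\<epsilon> = 1\<^sub>m n \<and> A\<epsilon> * R = 1\<^sub>m n \<and>
    \<epsilon> * mat_norm R \<le> 1 \<and> mat_norm R \<le> mat_norm B"
proof -
  have A\<epsilon>: "A\<epsilon> \<in> carrier_mat n n" using A by (simp add: A\<epsilon>_def)
  have expand: "(eucl_norm (A\<epsilon> *\<^sub>v v))\<^sup>2 =
      (eucl_norm (A *\<^sub>v v))\<^sup>2 + 2 * \<epsilon> * Re ((A *\<^sub>v v) \<bullet>c v) + (\<epsilon> * eucl_norm v)\<^sup>2"
    if v: "v \<in> carrier_vec n" for v
  proof -
    have "A\<epsilon> *\<^sub>v v = A *\<^sub>v v + (complex_of_real \<epsilon> \<cdot>\<^sub>m 1\<^sub>m n) *\<^sub>v v"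
      unfolding A\<epsilon>_def using A v by (intro add_mult_distrib_mat_vec) auto
    also have "(complex_of_real \<epsilon> \<cdot>\<^sub>m 1\<^sub>m n) *\<^sub>v v = complex_of_real \<epsilon> \<cdot>\<^sub>v v"
      using v by (intro eq_vecI) auto
    finally show ?thesis
      using A v by (simp add: eucl_norm_add_smult[of _ n] power_mult_distrib)
  qed
  have cross: "0 \<le> 2 * \<epsilon> * Re ((A *\<^sub>v v) \<bullet>c v)" if "v \<in> carrier_vec n" for v
    using Re_inner_nonneg_of_psd_Re[OF A that psd] \<epsilon> by simp
  have lower1: "\<epsilon> * eucl_norm v \<le> eucl_norm (A\<epsilon> *\<^sub>v v)" if "v \<in> carrier_vec n" for v
    by (rule power2_le_imp_le) (use expand[OF that] cross[OF that] in auto)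
  have lower2: "eucl_norm (A *\<^sub>v v) \<le> eucl_norm (A\<epsilon> *\<^sub>v v)" if "v \<in> carrier_vec n" for v
    by (rule power2_le_imp_le) (use expand[OF that] cross[OF that] in auto)
  have "det A\<epsilon> \<noteq> 0"
  proof
    assume "det A\<epsilon> = 0"
    then obtain v where v: "v \<in> carrier_vec n" "v \<noteq> 0\<^sub>v n" "A\<epsilon> *\<^sub>v v = 0\<^sub>v n"
      unfolding det_0_iff_vec_prod_zero_field[OF A\<epsilon>] by blast
    then have "eucl_norm v = 0"
      using lower1[OF v(1)] \<epsilon> eucl_norm_nonneg[of v] by (simp add: mult_le_0_iff)
    then show False using v eucl_norm_eq_0 by blast
  qed
  then obtain R where R: "R \<in> carrier_mat n n" "R * A\<epsilon> = 1\<^sub>m n" "A\<epsilon> * R = 1\<^sub>m n"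
    using det_non_zero_imp_unit[OF A\<epsilon>, of "()"] unfolding Units_def ring_mat_def by auto
  have R_inv: "A\<epsilon> *\<^sub>v (R *\<^sub>v w) = w" if "w \<in> carrier_vec n" for w
    using that R A\<epsilon> by (simp add: assoc_mult_mat_vec[symmetric])
  have "mat_norm R \<le> inverse \<epsilon>"
  proof (rule mat_norm_leI[OF R(1)])
    fix w :: "complex vec" assume w: "w \<in> carrier_vec n"
    then have "\<epsilon> * eucl_norm (R *\<^sub>v w) \<le> eucl_norm w"
      using lower1[of "R *\<^sub>v w"] R R_inv by auto
    then show "eucl_norm (R *\<^sub>v w) \<le> inverse \<epsilon> * eucl_norm w"
      using \<epsilon> by (simp add: field_simps)
  qed (use \<epsilon> in simp)
  moreover have "mat_norm R \<le> mat_norm B"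
  proof (rule mat_norm_leI[OF R(1)])
    fix w :: "complex vec" assume w: "w \<in> carrier_vec n"
    then have Rw: "R *\<^sub>v w \<in> carrier_vec n" using R by auto
    have "R *\<^sub>v w = B *\<^sub>v (A *\<^sub>v (R *\<^sub>v w))"
      using A B Rw by (simp add: assoc_mult_mat_vec[symmetric])
    then have "eucl_norm (R *\<^sub>v w) \<le> mat_norm B * eucl_norm (A *\<^sub>v (R *\<^sub>v w))"
      using eucl_norm_mult_mat_vec[OF B(1), of "A *\<^sub>v (R *\<^sub>v w)"] A Rw by auto
    also have "\<dots> \<le> mat_norm B * eucl_norm w"
      using lower2[OF Rw] R_inv[OF w] by (intro mult_left_mono) auto
    finally show "eucl_norm (R *\<^sub>v w) \<le> mat_norm B * eucl_norm w" .
  qed simp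
  ultimately show ?thesis using R \<epsilon> by (intro bexI[of _ R]) (auto simp: field_simps)
qed

lemma resolvent_defect:
  fixes A R H :: "complex mat"
  assumes A: "A \<in> carrier_mat n n" and R: "R \<in> carrier_mat n n" and H: "H \<in> carrier_mat n n"
  shows "R * (A + c \<cdot>\<^sub>m 1\<^sub>m n) = 1\<^sub>m n \<Longrightarrow> H * R * A - H = (- c) \<cdot>\<^sub>m (H * R)"
    and "(A + c \<cdot>\<^sub>m 1\<^sub>m n) * R = 1\<^sub>m n \<Longrightarrow> A * (R * H) - H = (- c) \<cdot>\<^sub>m (R * H)"
proof -
  have cancel: "P - H = (- c) \<cdot>\<^sub>m M"
    if "P \<in> carrier_mat n n" "M \<in> carrier_mat n n" "P + c \<cdot>\<^sub>m M = H" for P M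
    using that by (intro eq_matI) (auto simp flip: that(3))
  have HR: "H * R \<in> carrier_mat n n" and RH: "R * H \<in> carrier_mat n n"
    and c1: "c \<cdot>\<^sub>m 1\<^sub>m n \<in> carrier_mat n n" using R H by auto
  have A1: "A + c \<cdot>\<^sub>m 1\<^sub>m n \<in> carrier_mat n n" using A by auto
  show "H * R * A - H = (- c) \<cdot>\<^sub>m (H * R)" if "R * (A + c \<cdot>\<^sub>m 1\<^sub>m n) = 1\<^sub>m n"
  proof (rule cancel[OF mult_carrier_mat[OF HR A] HR])
    have "H = H * R * (A + c \<cdot>\<^sub>m 1\<^sub>m n)"
      by (simp add: assoc_mult_mat[OF H R A1] that right_mult_one_mat[OF H])
    also have "\<dots> = H * R * A + H * R * (c \<cdot>\<^sub>m 1\<^sub>m n)"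
      by (rule mult_add_distrib_mat[OF HR A c1])
    also have "H * R * (c \<cdot>\<^sub>m 1\<^sub>m n) = c \<cdot>\<^sub>m (H * R)"
      by (simp add: mult_smult_distrib[OF HR one_carrier_mat] right_mult_one_mat[OF HR])
    finally show "H * R * A + c \<cdot>\<^sub>m (H * R) = H" ..
  qed
  show "A * (R * H) - H = (- c) \<cdot>\<^sub>m (R * H)" if "(A + c \<cdot>\<^sub>m 1\<^sub>m n) * R = 1\<^sub>m n"
  proof (rule cancel[OF mult_carrier_mat[OF A RH] RH])
    have "H = (A + c \<cdot>\<^sub>m 1\<^sub>m n) * (R * H)"
      by (simp add: assoc_mult_mat[OF A1 R H, symmetric] that left_mult_one_mat[OF H])
    also have "\<dots> = A * (R * H) + (c \<cdot>\<^sub>m 1\<^sub>m n) * (R * H)"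
      by (rule add_mult_distrib_mat[OF A c1 RH])
    also have "(c \<cdot>\<^sub>m 1\<^sub>m n) * (R * H) = c \<cdot>\<^sub>m (R * H)"
      by (simp add: mult_smult_assoc_mat[OF one_carrier_mat RH] left_mult_one_mat[OF RH])
    finally show "A * (R * H) + c \<cdot>\<^sub>m (R * H) = H" ..
  qed
qed

section \<open>Cyclicity\<close>

theorem corollary5p5:
  fixes E :: "('h::complex_hilbert_space \<Rightarrow> 'h) set"
    and Q :: "'d::finite \<Rightarrow> 'h \<Rightarrow> 'h"
    and k :: nat
    and F :: "'d ncfun mat"
  assumes "operator_space_basis E Q"
    and "1 \<le> k"
    and "F \<in> mat_hinf k Q"
    and "Q_stable Q F"
    and "accretive Q F"
  shows "left_cyclic k Q F \<and> right_cyclic k Q F"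
proof -
  have Q: "\<forall>j. Q j \<in> bounded_operators"
    using operator_space_basis_bounded[OF assms(1)] by blast
  note F = assms(3)
  define \<epsilon> where "\<epsilon> N = inverse (real (Suc N))" for N
  have \<epsilon>: "0 < \<epsilon> N" for N by (simp add: \<epsilon>_def)
  have \<epsilon>_lim: "\<epsilon> \<longlonglongrightarrow> 0" unfolding \<epsilon>_def by (rule LIMSEQ_inverse_real_of_nat)
  define F\<epsilon> where "F\<epsilon> N X = mat_eval F X + complex_of_real (\<epsilon> N) \<cdot>\<^sub>m 1\<^sub>m (k * level X)" for N X
  note Fc = mat_eval_carrier[OF F]
  have "\<exists>B. B \<in> carrier_mat (k * level X) (k * level X) \<and> B * mat_eval F X = 1\<^sub>m (k * level X)"
    if "X \<in> nc_ball Q" for X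
    using det_non_zero_imp_unit[OF Fc, of X "()"] assms(4) that
    unfolding Q_stable_def Units_def ring_mat_def by auto
  then obtain B where B: "\<And>X. X \<in> nc_ball Q \<Longrightarrow> B X \<in> carrier_mat (k * level X) (k * level X)"
    "\<And>X. X \<in> nc_ball Q \<Longrightarrow> B X * mat_eval F X = 1\<^sub>m (k * level X)"
    by metis
  define is_resolvent where "is_resolvent N X R \<longleftrightarrow>
      R \<in> carrier_mat (k * level X) (k * level X) \<and> R * F\<epsilon> N X = 1\<^sub>m (k * level X) \<and>
      F\<epsilon> N X * R = 1\<^sub>m (k * level X) \<and> \<epsilon> N * mat_norm R \<le> 1 \<and> mat_norm R \<le> mat_norm (B X)"
    for N X R
  define R where "R N X = (SOME R. is_resolvent N X R)" for N X
  have "is_resolvent N X (R N X)" if X: "X \<in> nc_ball Q" for N X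
  proof -
    have "psd ((1/2) \<cdot>\<^sub>m (mat_eval F X + mat_adjoint (mat_eval F X)))"
      using assms(5) X by (simp add: accretive_def)
    from accretive_resolvent[OF Fc this B[OF X] \<epsilon>] have "\<exists>R. is_resolvent N X R"
      unfolding is_resolvent_def F\<epsilon>_def by blast
    then show ?thesis unfolding R_def by (rule someI_ex)
  qed
  then have R: "X \<in> nc_ball Q \<Longrightarrow> R N X \<in> carrier_mat (k * level X) (k * level X)"
    and RF: "X \<in> nc_ball Q \<Longrightarrow> R N X * F\<epsilon> N X = 1\<^sub>m (k * level X)"
    and FR: "X \<in> nc_ball Q \<Longrightarrow> F\<epsilon> N X * R N X = 1\<^sub>m (k * level X)"
    and R_le1: "X \<in> nc_ball Q \<Longrightarrow> \<epsilon> N * mat_norm (R N X) \<le> 1"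
    and R_le2: "X \<in> nc_ball Q \<Longrightarrow> mat_norm (R N X) \<le> mat_norm (B X)" for N X
    unfolding is_resolvent_def by blast+
  have nc_R: "nc_matfun k Q (R N)" for N
  proof (rule nc_matfun_inverse[OF Q, of k "F\<epsilon> N" "R N" "inverse (\<epsilon> N)"])
    show "nc_matfun k Q (F\<epsilon> N)"
      unfolding F\<epsilon>_def by (rule nc_matfun_add_scalar[OF Q nc_matfun_mat_eval[OF Q F]])
    show "mat_norm (R N X) \<le> inverse (\<epsilon> N)" if "X \<in> nc_ball Q" for X
      using R_le1[OF that, of N] \<epsilon>[of N] by (simp add: field_simps)
  qed (use R RF FR in auto)

  \<comment> \<open>Left and right multiples differ only in the order of the factors of the error, which its norm
    bound does not see. The uniform bound on the error comes from \<open>R_le1\<close>, the pointwise limit from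
    \<open>R_le2\<close>.\<close>
  have approx: "H \<in> weak_star k Q closure_of S"
    if H: "H \<in> mat_hinf k Q" and S: "\<And>N. A N \<in> S" and A: "\<And>N. A N \<in> mat_hinf k Q"
      and D: "\<And>N X. X \<in> nc_ball Q \<Longrightarrow> mat_norm (mat_eval (A N) X - mat_eval H X)
              \<le> \<epsilon> N * (mat_norm (mat_eval H X) * mat_norm (R N X))"
    for H S and A :: "nat \<Rightarrow> 'd ncfun mat"
  proof -
    obtain C where C: "\<And>X. X \<in> nc_ball Q \<Longrightarrow> mat_norm (mat_eval H X) \<le> C"
      using nc_matfun_mat_eval[OF Q H] unfolding nc_matfun_def by blast
    show ?thesis
    proof (rule weak_star_closureI[OF Q S A H])
      fix X assume X: "X \<in> nc_ball Q"
      show "mat_norm (mat_eval (A N) X - mat_eval H X) \<le> C" for N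
      proof -
        have "\<epsilon> N * (mat_norm (mat_eval H X) * mat_norm (R N X)) \<le> mat_norm (mat_eval H X)"
          using mult_left_le[OF R_le1[OF X, of N] mat_norm_nonneg[of "mat_eval H X"]]
          by (simp add: mult.left_commute)
        then show ?thesis using D[OF X, of N] C[OF X] by linarith
      qed
      have upper: "mat_norm (mat_eval (A N) X - mat_eval H X) \<le> \<epsilon> N * (mat_norm (mat_eval H X) * mat_norm (B X))" for N
        using \<epsilon>[of N] R_le2[OF X] by (intro order_trans[OF D[OF X]] mult_left_mono) auto
      have "(\<lambda>N. \<epsilon> N * (mat_norm (mat_eval H X) * mat_norm (B X))) \<longlonglongrightarrow> 0"
        using \<epsilon>_lim by (rule tendsto_mult_left_zero)
      then show "(\<lambda>N. mat_norm (mat_eval (A N) X - mat_eval H X)) \<longlonglongrightarrow> 0"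
        by (rule tendsto_sandwich[OF always_eventually always_eventually tendsto_const, rotated 2])
          (use upper in simp_all)
    qed
  qed

  have left: "H \<in> weak_star k Q closure_of {mat_hinf_mult Q G F |G. G \<in> mat_hinf k Q}"
    if H: "H \<in> mat_hinf k Q" for H
  proof -
    have "\<exists>P\<in>mat_hinf k Q. \<forall>X\<in>nc_ball Q. mat_eval P X = mat_eval H X * R N X" for N
      by (rule mat_hinf_of_nc_matfun[OF Q nc_matfun_mult[OF Q nc_matfun_mat_eval[OF Q H] nc_R]]) blast
    then obtain P where P: "\<And>N. P N \<in> mat_hinf k Q"
      "\<And>N X. X \<in> nc_ball Q \<Longrightarrow> mat_eval (P N) X = mat_eval H X * R N X" by metis
    show ?thesis
    proof (rule approx[OF H, of "\<lambda>N. mat_hinf_mult Q (P N) F"])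
      fix N X assume X: "X \<in> nc_ball Q"
      have "mat_eval (mat_hinf_mult Q (P N) F) X - mat_eval H X =
          (- complex_of_real (\<epsilon> N)) \<cdot>\<^sub>m (mat_eval H X * R N X)"
        unfolding mat_eval_mult[OF P(1) F X] P(2)[OF X]
        by (rule resolvent_defect(1)[OF Fc R[OF X] mat_eval_carrier[OF H] RF[OF X, unfolded F\<epsilon>_def]])
      then have "mat_norm (mat_eval (mat_hinf_mult Q (P N) F) X - mat_eval H X) \<le>
          \<epsilon> N * mat_norm (mat_eval H X * R N X)"
        using mat_norm_smult[OF mult_carrier_mat[OF mat_eval_carrier[OF H] R[OF X]], of "- complex_of_real (\<epsilon> N)"] \<epsilon>[of N]
        by simp
      also have "\<dots> \<le> \<epsilon> N * (mat_norm (mat_eval H X) * mat_norm (R N X))"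
        using \<epsilon>[of N] by (intro mult_left_mono mat_norm_mult[OF mat_eval_carrier[OF H] R[OF X]]) simp
      finally show "mat_norm (mat_eval (mat_hinf_mult Q (P N) F) X - mat_eval H X) \<le>
          \<epsilon> N * (mat_norm (mat_eval H X) * mat_norm (R N X))" .
    qed (use P(1) mat_hinf_mult_closed[OF Q P(1) F] in auto)
  qed
  have right: "H \<in> weak_star k Q closure_of {mat_hinf_mult Q F G |G. G \<in> mat_hinf k Q}"
    if H: "H \<in> mat_hinf k Q" for H
  proof -
    have "\<exists>P\<in>mat_hinf k Q. \<forall>X\<in>nc_ball Q. mat_eval P X = R N X * mat_eval H X" for N
      by (rule mat_hinf_of_nc_matfun[OF Q nc_matfun_mult[OF Q nc_R nc_matfun_mat_eval[OF Q H]]]) blast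
    then obtain P where P: "\<And>N. P N \<in> mat_hinf k Q"
      "\<And>N X. X \<in> nc_ball Q \<Longrightarrow> mat_eval (P N) X = R N X * mat_eval H X" by metis
    show ?thesis
    proof (rule approx[OF H, of "\<lambda>N. mat_hinf_mult Q F (P N)"])
      fix N X assume X: "X \<in> nc_ball Q"
      have "mat_eval (mat_hinf_mult Q F (P N)) X - mat_eval H X =
          (- complex_of_real (\<epsilon> N)) \<cdot>\<^sub>m (R N X * mat_eval H X)"
        unfolding mat_eval_mult[OF F P(1) X] P(2)[OF X]
        by (rule resolvent_defect(2)[OF Fc R[OF X] mat_eval_carrier[OF H] FR[OF X, unfolded F\<epsilon>_def]])
      then have "mat_norm (mat_eval (mat_hinf_mult Q F (P N)) X - mat_eval H X) \<le>
          \<epsilon> N * mat_norm (R N X * mat_eval H X)"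
        using mat_norm_smult[OF mult_carrier_mat[OF R[OF X] mat_eval_carrier[OF H]], of "- complex_of_real (\<epsilon> N)"] \<epsilon>[of N]
        by simp
      also have "\<dots> \<le> \<epsilon> N * (mat_norm (R N X) * mat_norm (mat_eval H X))"
        using \<epsilon>[of N] by (intro mult_left_mono mat_norm_mult[OF R[OF X] mat_eval_carrier[OF H]]) simp
      finally show "mat_norm (mat_eval (mat_hinf_mult Q F (P N)) X - mat_eval H X) \<le>
          \<epsilon> N * (mat_norm (mat_eval H X) * mat_norm (R N X))" by (simp only: mult.commute)
    qed (use P(1) mat_hinf_mult_closed[OF Q F P(1)] in auto)
  qed
  show ?thesis
    unfolding left_cyclic_def right_cyclic_def
    using left right closure_of_subset_topspace[of "weak_star k Q"]
    unfolding topspace_weak_star[OF Q] by blast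
qed

end
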